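(* Let $M$ be a real symmetric $n\times n$ matrix and let $G$ be the support graph of $M$. The following are equivalent: (1) the signed matrix $M(s)$ is singular for every symmetric signing $s$; (2) the support graph $G$ does not contain a perfect 2-matching. Moreover, there exists a polynomial-time algorithm to verify whether $M(s)$ is singular for every symmetric signing $s$.
   Context: A signing is an $n\times n$ matrix $s$ with entries in $\{\pm1\}$; it is symmetric if $s$ is a symmetric matrix, and $M(s)$ denotes the entry-wise product of $M$ and $s$. The support graph of $M$ is the undirected graph with vertex set $\{1,\dots,n\}$ and edge set $\{\{u,v\} : M[u,v]\neq 0\}$; it may contain self-loops $\{u,u\}$ when $M[u,u]\neq 0$. A perfect 2-matching in a graph with edge set $E$ is an assignment $x:E\to\{0,1,2\}$ such that $\sum_{e\in\delta(v)}x_e=2$ for every vertex $v$, where $\delta(v)$ is the set of edges incident to $v$. *)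

theory Defs
  imports
    "Jordan_Normal_Form.Matrix"
    "HOL-Computational_Algebra.Polynomial"
    "HOL-Library.Log_Nat"
begin

section \<open>Symmetric signings\<close>

definition sym_mat :: "'a mat \<Rightarrow> bool" where
  "sym_mat A \<longleftrightarrow> transpose_mat A = A"

definition signing :: "nat \<Rightarrow> real mat \<Rightarrow> bool" where
  "signing n s \<longleftrightarrow> s \<in> carrier_mat n n \<and> (\<forall>i<n. \<forall>j<n. s $$ (i, j) \<in> {- 1, 1})"

definition sym_signing :: "nat \<Rightarrow> real mat \<Rightarrow> bool" where
  "sym_signing n s \<longleftrightarrow> signing n s \<and> sym_mat s"

definition signed_mat :: "real mat \<Rightarrow> real mat \<Rightarrow> real mat" where
  "signed_mat M s = mat (dim_row M) (dim_col M) (\<lambda>(i, j). M $$ (i, j) * s $$ (i, j))"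

definition singular_mat :: "real mat \<Rightarrow> bool" where
  "singular_mat A \<longleftrightarrow> \<not> invertible_mat A"


section \<open>Support graph and perfect 2-matchings\<close>

text \<open>
  A graph is a pair of a vertex set and a set of edges, an edge being the set of its end points;
  the self-loop at \<open>u\<close> is \<open>{u, u} = {u}\<close>. Hence \<open>incident\<close> contains a self-loop at \<open>v\<close> once, so that
  it contributes its value once to the sum at \<open>v\<close>. Matrix indices, and with them the vertices,
  start at 0.
\<close>

type_synonym 'v graph = "'v set \<times> 'v set set"

definition support_graph :: "real mat \<Rightarrow> nat graph" where
  "support_graph M =
    ({..<dim_row M}, {{u, v} | u v. u < dim_row M \<and> v < dim_col M \<and> M $$ (u, v) \<noteq> 0})"

definition incident :: "'v graph \<Rightarrow> 'v \<Rightarrow> 'v set set" where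
  "incident G v = {e \<in> snd G. v \<in> e}"

definition perfect_2_matching :: "'v graph \<Rightarrow> ('v set \<Rightarrow> nat) \<Rightarrow> bool" where
  "perfect_2_matching G x \<longleftrightarrow>
    (\<forall>e \<in> snd G. x e \<in> {0, 1, 2}) \<and> (\<forall>v \<in> fst G. (\<Sum>e \<in> incident G v. x e) = 2)"


section \<open>Polynomial-time decidability for matrix problems\<close>

text \<open>
  The machine model is the random access machine with indirect addressing, whose registers hold
  real numbers (the real RAM). Program constants are integers, and there is no rounding
  operation. An indirect access through a register that does not contain a natural number, and a
  jump out of the program, crash the machine. Division by zero yields 0, as everywhere in HOL.
\<close>

datatype instr =
    Const nat int          \<comment> \<open>\<open>R[r] := c\<close>\<close>
  | Add nat nat nat        \<comment> \<open>\<open>R[r] := R[a] + R[b]\<close>\<close>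
  | Sub nat nat nat
  | Mul nat nat nat
  | Div nat nat nat
  | Load nat nat           \<comment> \<open>\<open>R[r] := R[R[a]]\<close>\<close>
  | Store nat nat          \<comment> \<open>\<open>R[R[r]] := R[a]\<close>\<close>
  | Jump nat
  | Jump_Zero nat nat      \<comment> \<open>continue at the second argument if \<open>R[r] = 0\<close>\<close>
  | Jump_Pos nat nat       \<comment> \<open>continue at the second argument if \<open>R[r] > 0\<close>\<close>
  | Halt bool

type_synonym memory = "nat \<Rightarrow> real"

datatype state = Running nat memory | Halted bool | Crashed

definition reg_index :: "real \<Rightarrow> nat" where
  "reg_index x = nat \<lfloor>x\<rfloor>"

fun exec :: "instr \<Rightarrow> nat \<Rightarrow> memory \<Rightarrow> state" where
  "exec (Const r c) pc R = Running (Suc pc) (R(r := of_int c))"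
| "exec (Add r a b) pc R = Running (Suc pc) (R(r := R a + R b))"
| "exec (Sub r a b) pc R = Running (Suc pc) (R(r := R a - R b))"
| "exec (Mul r a b) pc R = Running (Suc pc) (R(r := R a * R b))"
| "exec (Div r a b) pc R = Running (Suc pc) (R(r := R a / R b))"
| "exec (Load r a) pc R =
    (if R a \<in> \<nat> then Running (Suc pc) (R(r := R (reg_index (R a)))) else Crashed)"
| "exec (Store r a) pc R =
    (if R r \<in> \<nat> then Running (Suc pc) (R(reg_index (R r) := R a)) else Crashed)"
| "exec (Jump l) pc R = Running l R"
| "exec (Jump_Zero r l) pc R = Running (if R r = 0 then l else Suc pc) R"
| "exec (Jump_Pos r l) pc R = Running (if R r > 0 then l else Suc pc) R"
| "exec (Halt b) pc R = Halted b"

fun step :: "instr list \<Rightarrow> state \<Rightarrow> state" where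
  "step P (Running pc R) = (if pc < length P then exec (P ! pc) pc R else Crashed)"
| "step P (Halted b) = Halted b"
| "step P Crashed = Crashed"

text \<open>
  An \<open>n \<times> n\<close> matrix is given to the machine by its dimension in register 0 and its entries, row
  by row, in the registers \<open>1, \<dots>, n\<^sup>2\<close>; all other registers are 0 initially.
\<close>

definition input_memory :: "real mat \<Rightarrow> memory" where
  "input_memory M = (\<lambda>k. let n = dim_row M in
     if k = 0 then of_nat n
     else if k \<le> n * n then M $$ ((k - 1) div n, (k - 1) mod n)
     else 0)"

definition run :: "instr list \<Rightarrow> real mat \<Rightarrow> nat \<Rightarrow> state" where
  "run P M t = (step P ^^ t) (Running 0 (input_memory M))"

text \<open>
  Besides the number of steps (unit cost) we measure the logarithmic cost, in which an instruction
  is charged for the binary length of all addresses and numbers it handles. A rational number is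
  represented by numerator and denominator in lowest terms. On rational inputs all register
  contents remain rational, and polynomial logarithmic cost agrees with polynomial time on
  Turing machines. The value of \<open>rat_bits\<close> on irrational numbers is irrelevant.
\<close>

definition int_bits :: "int \<Rightarrow> nat" where
  "int_bits k = 1 + floorlog 2 (nat \<bar>k\<bar>)"

definition rat_bits :: "real \<Rightarrow> nat" where
  "rat_bits x = (case quotient_of (THE r. of_rat r = x) of (a, b) \<Rightarrow> int_bits a + int_bits b)"

fun instr_cost :: "instr \<Rightarrow> memory \<Rightarrow> nat" where
  "instr_cost (Const r c) R = int_bits (int r) + int_bits c"
| "instr_cost (Add r a b) R =
    int_bits (int r) + int_bits (int a) + int_bits (int b) + rat_bits (R a) + rat_bits (R b)"
| "instr_cost (Sub r a b) R =
    int_bits (int r) + int_bits (int a) + int_bits (int b) + rat_bits (R a) + rat_bits (R b)"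
| "instr_cost (Mul r a b) R =
    int_bits (int r) + int_bits (int a) + int_bits (int b) + rat_bits (R a) + rat_bits (R b)"
| "instr_cost (Div r a b) R =
    int_bits (int r) + int_bits (int a) + int_bits (int b) + rat_bits (R a) + rat_bits (R b)"
| "instr_cost (Load r a) R =
    int_bits (int r) + int_bits (int a) + rat_bits (R a) + rat_bits (R (reg_index (R a)))"
| "instr_cost (Store r a) R =
    int_bits (int r) + int_bits (int a) + rat_bits (R r) + rat_bits (R a)"
| "instr_cost (Jump l) R = int_bits (int l)"
| "instr_cost (Jump_Zero r l) R = int_bits (int r) + int_bits (int l) + rat_bits (R r)"
| "instr_cost (Jump_Pos r l) R = int_bits (int r) + int_bits (int l) + rat_bits (R r)"
| "instr_cost (Halt b) R = 1"

fun state_cost :: "instr list \<Rightarrow> state \<Rightarrow> nat" where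
  "state_cost P (Running pc R) = (if pc < length P then instr_cost (P ! pc) R else 0)"
| "state_cost P (Halted b) = 0"
| "state_cost P Crashed = 0"

definition log_cost :: "instr list \<Rightarrow> real mat \<Rightarrow> nat \<Rightarrow> nat" where
  "log_cost P M t = (\<Sum>k<t. state_cost P (run P M k))"

definition rational_mat :: "real mat \<Rightarrow> bool" where
  "rational_mat M \<longleftrightarrow> (\<forall>i<dim_row M. \<forall>j<dim_col M. M $$ (i, j) \<in> \<rat>)"

definition bit_size :: "real mat \<Rightarrow> nat" where
  "bit_size M = int_bits (int (dim_row M)) + (\<Sum>i<dim_row M. \<Sum>j<dim_col M. rat_bits (M $$ (i, j)))"

text \<open>
  \<open>D\<close> is the set of instances (square matrices) and \<open>Q\<close> the property to be decided. One program has
  to answer correctly on all real instances, with a number of steps polynomial in the dimension,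
  and on the rational instances it moreover has to run in time polynomial in the bit length of
  the input.
\<close>

definition poly_time_decidable :: "real mat set \<Rightarrow> (real mat \<Rightarrow> bool) \<Rightarrow> bool" where
  "poly_time_decidable D Q \<longleftrightarrow>
    (\<exists>(P :: instr list) (p :: nat poly) (q :: nat poly). \<forall>M \<in> D. \<exists>t.
       run P M t = Halted (Q M) \<and>
       t \<le> poly p (dim_row M) \<and>
       (rational_mat M \<longrightarrow> log_cost P M t \<le> poly q (bit_size M)))"

end

theory Submission
  imports Defs "Jordan_Normal_Form.Determinant"
begin

text \<open>
  Both conditions are equivalent to the absence of a permutation \<open>p\<close> with \<open>M[i, p i] \<noteq> 0\<close> for all
  \<open>i\<close>. Such a \<open>p\<close> gives the perfect 2-matching \<open>x{u, v} = [p u = v] + [p v = u]\<close>, and conversely a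
  perfect 2-matching is twice a doubly stochastic matrix on the support, so Hall's condition
  holds. In the determinant, seen as a polynomial in the signs, a monomial modulo \<open>s\<^sup>2 = 1\<close>
  records the edges that \<open>p\<close> uses once. Permutations with the same such edges differ by reversing
  long cycles and by rearranging two-cycles; hence they have the same sign and nothing cancels.

  The permutation is searched by an auction: an unassigned person takes the cheapest adjacent
  object, evicts its owner and raises its price by one. If all objects adjacent to the person cost
  at least \<open>n\<close>, then some price level between \<open>1\<close> and \<open>n\<close> is unused, and the objects above it
  violate Hall's condition. Thus there are at most \<open>n\<^sup>2\<close> rounds, and since the entries of the
  matrix are only tested for being zero, all numbers stay small.
\<close>

subsection \<open>Permutations with the same odd edges\<close>

text \<open>Both blocks are invariant, so the restriction to the union is the composition of the
  restrictions to the blocks, and the sign is multiplicative.\<close>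

lemma sign_on_disjoint_Un:
  assumes "finite A" "finite B" "A \<inter> B = {}" "bij_betw f A A" "bij_betw f B B"
  shows "sign_on (A \<union> B) f = sign_on A f * sign_on B f"
proof -
  have "x \<in> A \<longleftrightarrow> f x \<in> A" if "x \<in> A \<union> B" for x
    using that assms(3-5) unfolding bij_betw_def by blast
  then have "restrict_id f (A \<union> B) = restrict_id f A \<circ> restrict_id f B"
    using assms(3-5) by (auto simp: fun_eq_iff restrict_id_def bij_betw_def)
  moreover have "permutation (restrict_id f A)" "permutation (restrict_id f B)"
    using assms permutes_restrict_id by (auto simp: permutation_permutes)
  ultimately show ?thesis
    unfolding sign_on_def by (simp add: sign_compose)
qed

text \<open>\<open>f\<close> is a product of \<open>card W div 2\<close> disjoint transpositions;
  each contributes -1 to the sign and a pair of factors with product 1. Hence both values depend on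
  \<open>W\<close> alone, however \<open>f\<close> pairs up its elements. The induction removes one
  pair.\<close>

lemma fixpoint_free_involution:
  fixes h :: "'a \<Rightarrow> 'a \<Rightarrow> 'b::comm_monoid_mult"
  assumes "finite W" "\<And>x. x \<in> W \<Longrightarrow> f x \<in> W \<and> f x \<noteq> x \<and> f (f x) = x"
    and "\<And>x. x \<in> W \<Longrightarrow> h x (f x) * h (f x) x = 1"
  shows "sign_on W f = (- 1) ^ (card W div 2) \<and> (\<Prod>x\<in>W. h x (f x)) = 1"
  using assms
proof (induction "card W" arbitrary: W rule: less_induct)
  case less
  show ?case
  proof (cases "W = {}")
    case True
    then show ?thesis by (simp add: sign_on_def restrict_id_def)
  next
    case False
    then obtain x where x: "x \<in> W" by blast
    define y where "y = f x"
    have y: "y \<in> W" "y \<noteq> x" "f y = x" using less.prems(2)[OF x] by (auto simp: y_def)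
    define V where "V = W - {x, y}"
    have W: "W = insert x (insert y V)" "x \<notin> insert y V" "y \<notin> V" "finite V"
      using x y less.prems(1) by (auto simp: V_def)
    have c: "card W = Suc (Suc (card V))" using W by simp
    have V: "f z \<in> V \<and> f z \<noteq> z \<and> f (f z) = z" if "z \<in> V" for z
    proof -
      have "z \<in> W" "z \<noteq> x" "z \<noteq> y" using that by (auto simp: V_def)
      then show ?thesis using less.prems(2)[of z] less.prems(2)[OF x] y
        by (auto simp: V_def y_def)
    qed
    have IH: "sign_on V f = (- 1) ^ (card V div 2)" "(\<Prod>x\<in>V. h x (f x)) = 1"
      using less.hyps[of V] c V W less.prems(3) by auto
    have "bij_betw f V V"
      by (rule bij_betwI[where g = f]) (use V in auto)
    then have "permutation (restrict_id f V)"
      using permutes_restrict_id W(4) by (auto simp: permutation_permutes)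
    moreover have "restrict_id f W = Transposition.transpose x y \<circ> restrict_id f V"
    proof
      fix z
      consider "z = x" | "z = y" | "z \<in> V" | "z \<notin> W" using W(1) by blast
      then show "restrict_id f W z = (Transposition.transpose x y \<circ> restrict_id f V) z"
      proof cases
        case 3
        then have "f z \<in> V" "z \<in> W" using V W by auto
        then show ?thesis using 3 W by (auto simp: Transposition.transpose_def)
      next
        case 4
        then have "z \<notin> V" "z \<noteq> x" "z \<noteq> y" using W by auto
        then show ?thesis using 4 by simp
      qed (use W x y in \<open>auto simp: y_def\<close>)
    qed
    ultimately have "sign_on W f = - sign_on V f"
      unfolding sign_on_def using y(2)
      by (simp add: sign_compose sign_swap_id permutation_swap_id)
    moreover have "(\<Prod>x\<in>W. h x (f x)) = h x (f x) * h y (f y) * (\<Prod>x\<in>V. h x (f x))"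
      using W by (simp add: mult.assoc)
    ultimately show ?thesis using IH c less.prems(3)[OF x] y by (simp add: y_def)
  qed
qed

text \<open>The exponent of the sign of \<open>e\<close> in the determinant monomial of
  \<open>p\<close>. For a permutation it is 2 exactly when \<open>p\<close> swaps the two distinct
  ends of \<open>e\<close>.\<close>

definition edge_mult :: "nat \<Rightarrow> (nat \<Rightarrow> nat) \<Rightarrow> nat set \<Rightarrow> nat" where
  "edge_mult n p e = card ({0..<n} \<inter> {i. {i, p i} = e})"

lemma edge_mult_loop: "u < n \<Longrightarrow> edge_mult n p {u} = of_bool (p u = u)"
proof -
  assume "u < n"
  then have "{0..<n} \<inter> {i. {i, p i} = {u}} = (if p u = u then {u} else {})"
    by auto
  then show ?thesis by (simp add: edge_mult_def del: singleton_insert_inj_eq')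
qed

lemma edge_mult_edge:
  assumes "u < n" "v < n" "u \<noteq> v"
  shows "edge_mult n p {u, v} = of_bool (p u = v) + of_bool (p v = u)"
proof -
  have "{0..<n} \<inter> {i. {i, p i} = {u, v}} =
      (if p u = v then {u} else {}) \<union> (if p v = u then {v} else {})"
    using assms by (auto simp: doubleton_eq_iff)
  then show ?thesis using assms(3) by (simp add: edge_mult_def)
qed

text \<open>
  Such permutations agree up to reversing cycles of length at least three and rearranging the
  vertices on two-cycles.
\<close>

lemma same_odd_edges:
  fixes h :: "nat \<Rightarrow> nat \<Rightarrow> 'b::comm_monoid_mult"
  assumes p: "p permutes {0..<n}" and q: "q permutes {0..<n}"
    and par: "\<And>e. even (edge_mult n p e) \<longleftrightarrow> even (edge_mult n q e)"
    and hsym: "\<And>u v. h u v = h v u" and hsq: "\<And>u v. h u v * h u v = 1"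
  shows "sign p = sign q \<and> (\<Prod>i = 0..<n. h i (p i)) = (\<Prod>i = 0..<n. h i (q i))"
proof -
  let ?U = "{0..<n}"
  \<comment> \<open>A loop has multiplicity 0 or 1 and any other edge at most 2, so parity reveals
    the fixed points and the edges used in exactly one direction.\<close>
  have fix_eq: "p u = u \<longleftrightarrow> q u = u" if "u \<in> ?U" for u
    using par[of "{u}"] that by (auto simp: edge_mult_loop of_bool_def split: if_splits)
  have edge: "(p u = v) \<noteq> (p v = u) \<longleftrightarrow> (q u = v) \<noteq> (q v = u)"
    if "u \<in> ?U" "v \<in> ?U" "u \<noteq> v" for u v
    using par[of "{u, v}"] that by (auto simp: edge_mult_edge of_bool_def split: if_splits)
  have inU: "p u \<in> ?U" "q u \<in> ?U" if "u \<in> ?U" for u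
    using p q that by (meson permutes_in_image)+
  have inj: "p u = p v \<longleftrightarrow> u = v" "q u = q v \<longleftrightarrow> u = v" for u v
    using p q by (meson injD permutes_inj)+
  \<comment> \<open>Otherwise \<open>q\<close> uses \<open>{u, q u}\<close> in one direction only,
    and so does \<open>p\<close>; but \<open>p (p u) = u\<close> makes \<open>p\<close> use an edge
    from \<open>u\<close> to another vertex both ways or not at all.\<close>
  have two_p: "q (q u) = u" if "u \<in> ?U" "p (p u) = u" for u
  proof (rule ccontr)
    assume *: "q (q u) \<noteq> u"
    then have "q u \<noteq> u" by auto
    then have "(p u = q u) \<noteq> (p (q u) = u)"
      using edge[of u "q u"] inU that * by auto
    then show False using that(2) inj(1) by metis
  qed
  have two_q: "p (p u) = u" if "u \<in> ?U" "q (q u) = u" for u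
  proof (rule ccontr)
    assume *: "p (p u) \<noteq> u"
    then have "p u \<noteq> u" by auto
    then have "(q u = p u) \<noteq> (q (p u) = u)"
      using edge[of u "p u"] inU that * by auto
    then show False using that(2) inj(2) by metis
  qed
  \<comment> \<open>\<open>W\<close> holds the two-cycles, \<open>C\<close> the longer cycles that
    \<open>p\<close> and \<open>q\<close> traverse in opposite directions, and \<open>B\<close> the
    fixed points and the longer cycles on which they agree.\<close>
  define W where "W = {u \<in> ?U. q (q u) = u \<and> q u \<noteq> u}"
  define C where "C = {u \<in> ?U. q (q u) \<noteq> u \<and> p u \<noteq> q u}"
  define B where "B = {u \<in> ?U. q u = u \<or> q (q u) \<noteq> u \<and> p u = q u}"
  have U: "?U = W \<union> (B \<union> C)" "W \<inter> (B \<union> C) = {}" "B \<inter> C = {}"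
    by (auto simp: W_def B_def C_def)
  have fin: "finite W" "finite B" "finite C"
    by (auto simp: W_def B_def C_def)
  have Wp: "p x \<in> W \<and> p x \<noteq> x \<and> p (p x) = x" if "x \<in> W" for x
    using that inU[of x] two_q[of x] two_p[of "p x"] fix_eq[of x] fix_eq[of "p x"] inj
    by (auto simp: W_def)
  have Wq: "q x \<in> W \<and> q x \<noteq> x \<and> q (q x) = x" if "x \<in> W" for x
    using that inU[of x] by (auto simp: W_def)
  have B_eq: "p x = q x" if "x \<in> B" for x
    using that fix_eq[of x] by (auto simp: B_def)
  \<comment> \<open>\<open>q\<close> uses \<open>{x, q x}\<close> once and \<open>p\<close> does not
    leave \<open>x\<close> along it, so \<open>p\<close> must traverse it backwards.\<close>
  have Cq: "p (q x) = x \<and> q x \<in> C" if "x \<in> C" for x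
  proof -
    have x: "x \<in> ?U" "q (q x) \<noteq> x" "p x \<noteq> q x" "q x \<noteq> x" using that by (auto simp: C_def)
    then have "p (q x) = x" using edge[of x "q x"] inU by auto
    then show ?thesis using x inU inj by (auto simp: C_def)
  qed
  have Cp: "q (p x) = x \<and> p x \<in> C" if "x \<in> C" for x
  proof -
    have x: "x \<in> ?U" "p (p x) \<noteq> x" "p x \<noteq> q x" "p x \<noteq> x"
      using that two_p[of x] fix_eq[of x] by (auto simp: C_def)
    then have "q (p x) = x" using edge[of x "p x"] inU by auto
    moreover have "q (q (p x)) \<noteq> p x" using x calculation by auto
    ultimately show ?thesis using x inU by (auto simp: C_def)
  qed
  have Bq: "q x \<in> B" if "x \<in> B" for x
  proof (cases "q x = x")
    case False
    then have x: "x \<in> ?U" "q (q x) \<noteq> x" "p x = q x" using that by (auto simp: B_def)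
    have "q x \<notin> W" using x inj by (auto simp: W_def)
    \<comment> \<open>On \<open>C\<close> the permutation \<open>p\<close> reverses
      \<open>q\<close>, giving \<open>p (q x) = x\<close>; with \<open>p x = q x\<close> this closes
      a two-cycle.\<close>
    moreover have "q x \<notin> C"
    proof
      assume "q x \<in> C"
      then have "q (p (q x)) = q x" "p (q x) \<noteq> q (q x)" using Cp by (auto simp: C_def)
      then have "p (q x) = x" using inj by auto
      then show False using x two_p by metis
    qed
    ultimately show ?thesis using inU x U by blast
  qed (use that in auto)
  have bW: "bij_betw p W W" "bij_betw q W W"
    by (rule bij_betwI[where g = p]; use Wp in auto)
       (rule bij_betwI[where g = q]; use Wq in auto)
  have bC: "bij_betw p C C" "bij_betw q C C"
    by (rule bij_betwI[where g = q]; use Cp Cq in auto)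
       (rule bij_betwI[where g = p]; use Cp Cq in auto)
  have bBq: "bij_betw q B B"
    using endo_inj_surj[of B q] Bq inj(2) fin(2) by (auto simp: bij_betw_def inj_on_def)
  have bBp: "bij_betw p B B"
    using bBq B_eq by (simp cong: bij_betw_cong)
  have split: "sign r = sign_on W r * (sign_on B r * sign_on C r)"
    if "r permutes ?U" "bij_betw r W W" "bij_betw r B B" "bij_betw r C C" for r
  proof -
    have "sign r = sign_on ?U r" using that(1) by (simp add: sign_on_permutes)
    also have "\<dots> = sign_on W r * sign_on (B \<union> C) r"
      unfolding U(1) by (rule sign_on_disjoint_Un) (use that U(2,3) fin bij_betw_combine in auto)
    also have "sign_on (B \<union> C) r = sign_on B r * sign_on C r"
      by (rule sign_on_disjoint_Un) (use that U(3) fin in auto)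
    finally show ?thesis .
  qed
  have psplit: "(\<Prod>i = 0..<n. h i (r i)) =
      (\<Prod>i\<in>W. h i (r i)) * ((\<Prod>i\<in>B. h i (r i)) * (\<Prod>i\<in>C. h i (r i)))" for r
    unfolding U(1) using fin U by (simp add: prod.union_disjoint)
  have W: "sign_on W p = sign_on W q \<and> (\<Prod>i\<in>W. h i (p i)) = (\<Prod>i\<in>W. h i (q i))"
    using fixpoint_free_involution[of W p h] fixpoint_free_involution[of W q h] fin(1) Wp Wq
      hsym hsq by metis
  have B: "sign_on B p = sign_on B q" "(\<Prod>i\<in>B. h i (p i)) = (\<Prod>i\<in>B. h i (q i))"
    using B_eq by (auto intro!: sign_on_cong prod.cong)
  \<comment> \<open>\<open>p\<close> inverts \<open>q\<close> on \<open>C\<close>, so the two signs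
    multiply to 1.\<close>
  have "sign_on C p * sign_on C q = sign_on C (p \<circ> q)"
    using bC fin(3) by (rule sign_on_compose[symmetric])
  also have "\<dots> = sign_on C id" by (rule sign_on_cong) (use Cq in auto)
  finally have "sign_on C p * sign_on C q = 1" by simp
  then have C: "sign_on C p = sign_on C q"
    unfolding sign_on_def by (simp add: sign_def split: if_splits)
  \<comment> \<open>Reindexing along \<open>q\<close> turns each factor into
    \<open>h (q i) i\<close>, and \<open>h\<close> is symmetric.\<close>
  have "(\<Prod>i\<in>C. h i (p i)) = (\<Prod>i\<in>C. h (q i) (p (q i)))"
    using bC(2) by (simp add: prod.reindex_bij_betw[of q C C "\<lambda>i. h i (p i)"])
  also have "\<dots> = (\<Prod>i\<in>C. h i (q i))"
    by (rule prod.cong) (use Cq hsym in auto)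
  finally show ?thesis
    using split[OF p bW(1) bBp bC(1)] split[OF q bW(2) bBq bC(2)] psplit W B C by simp
qed

subsection \<open>Nonsingular signings\<close>

text \<open>Edge sets parametrise the symmetric sign matrices: \<open>F\<close> collects the edges
  with sign -1.\<close>

definition edge_sign :: "nat set set \<Rightarrow> nat \<Rightarrow> nat \<Rightarrow> real" where
  "edge_sign F u v = (if {u, v} \<in> F then - 1 else 1)"

text \<open>The sign monomial of \<open>p\<close> evaluated at \<open>F\<close>. As a function of
  \<open>F\<close> it is a character of the group of edge sets under symmetric difference.\<close>

definition sign_char :: "nat \<Rightarrow> nat set set \<Rightarrow> (nat \<Rightarrow> nat) \<Rightarrow> real" where
  "sign_char n F p = (\<Prod>i = 0..<n. edge_sign F i (p i))"

lemma sign_char_flip: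
  "sign_char n (sym_diff F {e}) p = (- 1) ^ edge_mult n p e * sign_char n F p"
proof -
  have "sign_char n (sym_diff F {e}) p =
      (\<Prod>i = 0..<n. (if {i, p i} = e then - 1 else 1) * edge_sign F i (p i))"
    unfolding sign_char_def
  proof (rule prod.cong)
    fix i
    show "edge_sign (sym_diff F {e}) i (p i) =
        (if {i, p i} = e then - 1 else 1) * edge_sign F i (p i)"
      by (cases "{i, p i} = e"; cases "{i, p i} \<in> F") (simp_all add: edge_sign_def)
  qed simp
  also have "\<dots> = (\<Prod>i = 0..<n. if {i, p i} = e then - 1 else 1) * sign_char n F p"
    unfolding sign_char_def by (simp add: prod.distrib)
  also have "(\<Prod>i = 0..<n. if {i, p i} = e then - 1 else (1::real)) = (- 1) ^ edge_mult n p e"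
    unfolding edge_mult_def by (simp add: prod.If_cases Int_def)
  finally show ?thesis .
qed

text \<open>Toggling \<open>e\<close> permutes \<open>Pow E\<close> and negates each summand, so the
  sum equals its own negative.\<close>

lemma sign_char_orthogonal:
  assumes "e \<in> E" "even (edge_mult n p e) \<noteq> even (edge_mult n q e)"
  shows "(\<Sum>F\<in>Pow E. sign_char n F p * sign_char n F q) = 0"
proof -
  let ?f = "\<lambda>F. sign_char n F p * sign_char n F q"
  have "(\<Sum>F\<in>Pow E. ?f F) = (\<Sum>F\<in>Pow E. ?f (sym_diff F {e}))"
    by (rule sum.reindex_bij_betw[symmetric],
        rule bij_betwI[where g = "\<lambda>F. sym_diff F {e}"]) (use assms(1) in auto)
  also have "\<dots> = (\<Sum>F\<in>Pow E. - ?f F)"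
    unfolding sign_char_flip using assms(2) by (intro sum.cong) (auto simp: minus_one_power_iff)
  finally show ?thesis by (simp add: sum_negf)
qed

lemma invertible_mat_iff_det:
  fixes A :: "'a::field mat"
  assumes A: "A \<in> carrier_mat n n"
  shows "invertible_mat A \<longleftrightarrow> det A \<noteq> 0"
proof
  assume "invertible_mat A"
  then obtain B where B: "A * B = 1\<^sub>m n" "B * A = 1\<^sub>m (dim_row B)"
    using A by (auto simp: invertible_mat_def inverts_mat_def)
  \<comment> \<open>The inverse comes without dimensions; the two product equations force both to be
    \<open>n\<close>.\<close>
  have "dim_col B = n" using arg_cong[OF B(1), of dim_col] by simp
  moreover have "dim_row B = n" using arg_cong[OF B(2), of dim_col] A by simp
  ultimately have "B \<in> carrier_mat n n" by (intro carrier_matI)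
  then have "det A * det B = 1" using B(1) A det_mult[of A n B] by simp
  then show "det A \<noteq> 0" by auto
next
  assume "det A \<noteq> 0"
  then have "A \<in> Units (ring_mat TYPE('a) n ())" using A by (rule det_non_zero_imp_unit[rotated])
  then obtain B where "B \<in> carrier_mat n n" "A * B = 1\<^sub>m n" "B * A = 1\<^sub>m n"
    by (auto simp: Units_def ring_mat_def)
  then show "invertible_mat A"
    using A by (auto simp: invertible_mat_def inverts_mat_def)
qed

lemma sym_matD: "sym_mat A \<Longrightarrow> A \<in> carrier_mat n n \<Longrightarrow> i < n \<Longrightarrow> j < n \<Longrightarrow> A $$ (i, j) = A $$ (j, i)"
  unfolding sym_mat_def by (metis carrier_matD index_transpose_mat(1))

text \<open>
  Signs are averaged against the character of \<open>p\<close>. Only permutations with the same odd edges as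
  \<open>p\<close> survive, and all of these contribute with the sign of \<open>p\<close>. Absorbing the signs of the
  entries into the signing makes the matrix nonnegative.
\<close>

lemma nonsingular_signing_of_permutation:
  assumes M: "M \<in> carrier_mat n n" and sym: "sym_mat M"
    and p: "p permutes {0..<n}" and nz: "\<And>i. i < n \<Longrightarrow> M $$ (i, p i) \<noteq> 0"
  shows "\<exists>s. sym_signing n s \<and> \<not> singular_mat (signed_mat M s)"
proof -
  \<comment> \<open>The power set is a convenient finite family containing every edge
    \<open>{i, q i}\<close> of a permutation \<open>q\<close>.\<close>
  define E where "E = Pow {0..<n}"
  define s where "s F = mat n n (\<lambda>(i, j). edge_sign F i j * (if M $$ (i, j) < 0 then - 1 else 1))" for F
  define a where "a q = (\<Prod>i = 0..<n. \<bar>M $$ (i, q i)\<bar>)" for q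
  have s_sym: "sym_signing n (s F)" for F
    unfolding sym_signing_def signing_def sym_mat_def
    by (auto simp: s_def edge_sign_def insert_commute intro!: eq_matI)
       (auto simp: sym_matD[OF sym M])
  have carrier: "signed_mat M (s F) \<in> carrier_mat n n" for F
    using M by (simp add: signed_mat_def)
  have det: "det (signed_mat M (s F)) =
      (\<Sum>q | q permutes {0..<n}. of_int (sign q) * a q * sign_char n F q)" for F
  proof -
    have "(\<Prod>i = 0..<n. signed_mat M (s F) $$ (i, q i)) = a q * sign_char n F q"
      if "q permutes {0..<n}" for q
    proof -
      have "signed_mat M (s F) $$ (i, q i) = \<bar>M $$ (i, q i)\<bar> * edge_sign F i (q i)"
        if "i < n" for i
      proof -
        have "q i < n" using \<open>q permutes {0..<n}\<close> that permutes_in_image by fastforce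
        then show ?thesis using M that by (simp add: signed_mat_def s_def)
      qed
      then show ?thesis by (simp add: a_def sign_char_def prod.distrib)
    qed
    then show ?thesis unfolding det_def'[OF carrier] by (intro sum.cong) auto
  qed
  \<comment> \<open>The unnormalised inner product of the characters of \<open>p\<close> and
    \<open>q\<close>.\<close>
  define S where "S q = (\<Sum>F\<in>Pow E. sign_char n F p * sign_char n F q)" for q
  have sq: "sign_char n F q * sign_char n F q = 1" for F q
    unfolding sign_char_def prod.distrib[symmetric]
    by (rule prod.neutral) (simp add: edge_sign_def)
  have nonneg: "of_int (sign p * sign q) * a q * S q \<ge> 0" if q: "q permutes {0..<n}" for q
  proof (cases "\<forall>e. even (edge_mult n p e) \<longleftrightarrow> even (edge_mult n q e)")
    case True
    then have same: "sign p = sign q" "sign_char n F p = sign_char n F q" for F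
      using same_odd_edges[OF p q, of "edge_sign F"]
      by (auto simp: sign_char_def edge_sign_def insert_commute)
    then have "S q \<ge> 0" unfolding S_def by (intro sum_nonneg) (simp add: sq)
    moreover have "a q \<ge> 0" unfolding a_def by (intro prod_nonneg) auto
    ultimately show ?thesis by (simp add: same)
  next
    case False
    then obtain e where e: "even (edge_mult n p e) \<noteq> even (edge_mult n q e)" by blast
    \<comment> \<open>An odd multiplicity is nonzero, so one of the permutations uses
      \<open>e\<close>, whose ends are then below \<open>n\<close>.\<close>
    then have "edge_mult n p e \<noteq> 0 \<or> edge_mult n q e \<noteq> 0" by auto
    then have "{0..<n} \<inter> {i. {i, p i} = e} \<noteq> {} \<or> {0..<n} \<inter> {i. {i, q i} = e} \<noteq> {}"
      unfolding edge_mult_def by (metis card.empty)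
    then have "e \<in> E"
      using permutes_in_image[OF p] permutes_in_image[OF q] unfolding E_def by blast
    then have "S q = 0" unfolding S_def using e by (rule sign_char_orthogonal)
    then show ?thesis by simp
  qed
  have "S p = card (Pow E)" by (simp add: S_def sq)
  then have "S p > 0" by (simp add: E_def card_Pow)
  moreover have "a p > 0" unfolding a_def by (intro prod_pos) (use nz in auto)
  ultimately have pos: "of_int (sign p * sign p) * a p * S p > 0" by simp
  \<comment> \<open>Expanding the determinants and exchanging the sums identifies this positive
    number with a weighted sum of determinants of signed matrices; one of them must be
    nonzero.\<close>
  have "0 < (\<Sum>q | q permutes {0..<n}. of_int (sign p * sign q) * a q * S q)"
    by (rule sum_pos2[where i = p]) (use p pos nonneg finite_permutations in auto)
  also have "\<dots> = (\<Sum>F\<in>Pow E. of_int (sign p) * sign_char n F p * det (signed_mat M (s F)))"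
    unfolding det S_def sum_distrib_left sum_distrib_right
    by (subst sum.swap) (simp add: ac_simps)
  finally obtain F where "det (signed_mat M (s F)) \<noteq> 0"
    by (metis (no_types, lifting) less_irrefl mult_zero_right sum.neutral)
  then show ?thesis
    using s_sym invertible_mat_iff_det[OF carrier] unfolding singular_mat_def by blast
qed

text \<open>Every Leibniz term contains a zero entry of \<open>M\<close>, which no sign can
  repair.\<close>

lemma singular_signing_if_no_permutation:
  assumes M: "M \<in> carrier_mat n n"
    and no: "\<And>p. p permutes {0..<n} \<Longrightarrow> \<exists>i<n. M $$ (i, p i) = 0"
  shows "singular_mat (signed_mat M s)"
proof -
  have carrier: "signed_mat M s \<in> carrier_mat n n"
    using M by (simp add: signed_mat_def)
  have "(\<Prod>i = 0..<n. signed_mat M s $$ (i, p i)) = 0" if p: "p permutes {0..<n}" for p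
  proof -
    obtain i where i: "i < n" "M $$ (i, p i) = 0" using no[OF p] by blast
    then have "p i < n" using p permutes_in_image by fastforce
    then have "signed_mat M s $$ (i, p i) = 0" using i M by (simp add: signed_mat_def)
    then show ?thesis using i(1) by (auto intro!: prod_zero)
  qed
  then have "det (signed_mat M s) = 0" unfolding det_def'[OF carrier] by (intro sum.neutral) simp
  then show ?thesis using carrier by (simp add: singular_mat_def invertible_mat_iff_det)
qed

lemma all_signings_singular_iff:
  assumes "M \<in> carrier_mat n n" "sym_mat M"
  shows "(\<forall>s. sym_signing n s \<longrightarrow> singular_mat (signed_mat M s)) \<longleftrightarrow>
    \<not> (\<exists>p. p permutes {0..<n} \<and> (\<forall>i<n. M $$ (i, p i) \<noteq> 0))"
  using nonsingular_signing_of_permutation[OF assms] singular_signing_if_no_permutation[OF assms(1)]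
  by blast

subsection \<open>Perfect matchings by ascending auction\<close>

text \<open>
  Persons bid for adjacent objects. The slack condition says that an assigned object is, up to
  the last bid, among the cheapest ones its owner can get.
\<close>

definition auction_state ::
    "nat \<Rightarrow> (nat \<Rightarrow> nat \<Rightarrow> bool) \<Rightarrow> nat set \<Rightarrow> (nat \<Rightarrow> nat) \<Rightarrow> (nat \<rightharpoonup> nat) \<Rightarrow> bool" where
  "auction_state n E S price owner \<longleftrightarrow>
    (\<forall>j<n. price j \<le> n \<and> (owner j = None \<longrightarrow> price j = 0)) \<and>
    (\<forall>j i. owner j = Some i \<longrightarrow> j < n \<and> E i j \<and> (\<forall>k<n. E i k \<longrightarrow> price j \<le> price k + 1)) \<and>
    (\<forall>j j' i. owner j = Some i \<longrightarrow> owner j' = Some i \<longrightarrow> j = j') \<and>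
    ran owner = S \<and> S \<subseteq> {0..<n}"

text \<open>\<open>T\<close> may be any superset of the neighbourhood of \<open>X\<close>, such as
  the set of objects above a price level.\<close>

definition hall_violation :: "nat \<Rightarrow> (nat \<Rightarrow> nat \<Rightarrow> bool) \<Rightarrow> bool" where
  "hall_violation n E \<longleftrightarrow> (\<exists>X T. X \<subseteq> {0..<n} \<and> T \<subseteq> {0..<n} \<and> card T < card X \<and>
    (\<forall>i\<in>X. \<forall>j<n. E i j \<longrightarrow> j \<in> T))"

definition perfect_matching :: "nat \<Rightarrow> (nat \<Rightarrow> nat \<Rightarrow> bool) \<Rightarrow> bool" where
  "perfect_matching n E \<longleftrightarrow> (\<exists>p. p permutes {0..<n} \<and> (\<forall>i<n. E i (p i)))"

lemma no_perfect_matching_if_hall_violation: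
  assumes "hall_violation n E"
  shows "\<not> perfect_matching n E"
proof
  assume "perfect_matching n E"
  then obtain p where p: "p permutes {0..<n}" "\<And>i. i < n \<Longrightarrow> E i (p i)"
    by (auto simp: perfect_matching_def)
  obtain X T where XT: "X \<subseteq> {0..<n}" "T \<subseteq> {0..<n}" "card T < card X"
      "\<And>i j. i \<in> X \<Longrightarrow> j < n \<Longrightarrow> E i j \<Longrightarrow> j \<in> T"
    using assms unfolding hall_violation_def by metis
  have "p ` X \<subseteq> T"
  proof (rule image_subsetI)
    fix i assume i: "i \<in> X"
    then have "i < n" using XT(1) by auto
    then have "p i < n" "E i (p i)" using p permutes_in_image[OF p(1), of i] by auto
    then show "p i \<in> T" using XT(4) i by blast
  qed
  moreover have "inj_on p X" using permutes_inj[OF p(1)] by (rule inj_on_subset) simp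
  ultimately have "card X \<le> card T"
    using card_inj_on_le finite_subset[OF XT(2)] by blast
  then show False using XT(3) by simp
qed

lemma auction_state_init: "auction_state n E {} (\<lambda>_. 0) (\<lambda>_. None)"
  by (simp add: auction_state_def)

lemma card_assigned_objects:
  assumes "auction_state n E S price owner"
  shows "card (dom owner) = card S"
proof -
  have inj: "\<And>j j' i. owner j = Some i \<Longrightarrow> owner j' = Some i \<Longrightarrow> j = j'" and ran: "ran owner = S"
    using assms by (auto simp: auction_state_def)
  have "inj_on (\<lambda>j. the (owner j)) (dom owner)"
    by (rule inj_onI) (metis inj domD option.sel)
  moreover have "(\<lambda>j. the (owner j)) ` dom owner = S"
    unfolding ran[symmetric] by (force simp: ran_def image_iff)
  ultimately show ?thesis by (metis card_image)
qed

text \<open>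
  Fewer than \<open>n\<close> objects have a positive price, so some price level between \<open>1\<close> and \<open>n\<close> is not
  taken. By slackness, the owners of the objects above it, and \<open>c\<close>, only see such objects.
\<close>

lemma hall_violation_if_stuck:
  assumes state: "auction_state n E S price owner" and c: "c < n" "c \<notin> S"
    and stuck: "\<And>k. k < n \<Longrightarrow> E c k \<Longrightarrow> n \<le> price k"
  shows "hall_violation n E"
proof -
  have S: "S \<subseteq> {0..<n}" and unassigned: "\<And>j. j < n \<Longrightarrow> owner j = None \<Longrightarrow> price j = 0"
    and owned: "\<And>j i. owner j = Some i \<Longrightarrow>
      j < n \<and> E i j \<and> i \<in> S \<and> (\<forall>k<n. E i k \<longrightarrow> price j \<le> price k + 1)"
    and inj: "\<And>j j' i. owner j = Some i \<Longrightarrow> owner j' = Some i \<Longrightarrow> j = j'"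
    using state by (auto simp: auction_state_def ran_def)
  have fin: "finite (dom owner)" using owned by (auto intro: finite_subset[of _ "{0..<n}"])
  \<comment> \<open>\<open>c\<close> is unassigned, so at most \<open>n - 1\<close> objects have an
    owner, too few to occupy \<open>n\<close> price levels.\<close>
  have "card S < card {0..<n}"
    by (rule psubset_card_mono) (use S c in auto)
  then have "card (price ` dom owner) < card {1..n}"
    using card_image_le[OF fin, of price] card_assigned_objects[OF state] by simp
  then obtain L where L: "L \<in> {1..n}" "L \<notin> price ` dom owner"
    using card_mono[of "price ` dom owner" "{1..n}"] fin by fastforce
  have gap: "price j \<noteq> L" if "j < n" for j
    using L unassigned[OF that] by (cases "owner j") auto
  define T where "T = {j. j < n \<and> L < price j}"
  define f where "f j = the (owner j)" for j
  have T_owned: "owner j = Some (f j)" if "j \<in> T" for j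
    using that unassigned[of j] by (cases "owner j") (auto simp: T_def f_def)
  have finT: "finite T" by (simp add: T_def)
  have "inj_on f T" using T_owned inj by (metis inj_onI)
  moreover have "c \<notin> f ` T" using T_owned owned c(2) by blast
  ultimately have "card T < card (insert c (f ` T))"
    using finT by (simp add: card_image)
  moreover have "insert c (f ` T) \<subseteq> {0..<n}" using T_owned owned S c(1) by fastforce
  \<comment> \<open>Slackness only gives \<open>price k \<ge> price j - 1 \<ge> L\<close>; since no
    object costs exactly \<open>L\<close>, this already places \<open>k\<close> above the gap. For
    \<open>c\<close>, use \<open>n \<ge> L\<close>.\<close>
  moreover have "k \<in> T" if i: "i \<in> insert c (f ` T)" and k: "k < n" "E i k" for i k
  proof -
    have "L \<le> price k"
    proof (cases "i = c")
      case True
      then show ?thesis using stuck k L(1) by fastforce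
    next
      case False
      then obtain j where j: "j \<in> T" "i = f j" using i by blast
      then have "price j \<le> price k + 1" using owned[OF T_owned[OF j(1)]] k by blast
      then show ?thesis using j by (simp add: T_def)
    qed
    then show ?thesis using gap[OF k(1)] k(1) by (simp add: T_def)
  qed
  moreover have "T \<subseteq> {0..<n}" by (auto simp: T_def)
  ultimately show ?thesis unfolding hall_violation_def by meson
qed

text \<open>Slackness survives: \<open>b\<close> was cheapest for \<open>c\<close>, so after the
  increment it is at most one above the alternatives, and for the other owners only a right-hand
  side can grow.\<close>

lemma auction_state_bid:
  assumes state: "auction_state n E S price owner" and c: "c < n" "c \<notin> S"
    and b: "b < n" "E c b" "price b < n" and cheapest: "\<And>k. k < n \<Longrightarrow> E c k \<Longrightarrow> price b \<le> price k"
  shows "auction_state n E (insert c (S - set_option (owner b)))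
    (price(b := Suc (price b))) (owner(b \<mapsto> c))"
proof -
  have ran: "ran owner = S"
    and inj: "\<And>j j' i. owner j = Some i \<Longrightarrow> owner j' = Some i \<Longrightarrow> j = j'"
    using state by (auto simp: auction_state_def)
  have c_not: "owner j \<noteq> Some c" for j using c(2) ran by (auto simp: ran_def)
  have "ran (owner(b \<mapsto> c)) = insert c (S - set_option (owner b))"
  proof (rule Set.set_eqI)
    fix i
    show "i \<in> ran (owner(b \<mapsto> c)) \<longleftrightarrow> i \<in> insert c (S - set_option (owner b))"
      using inj[of b i] unfolding ran[symmetric] by (auto simp: ran_def)
  qed
  moreover have "price j \<le> (price(b := Suc (price b))) j" for j by simp
  ultimately show ?thesis
    using state c b cheapest c_not unfolding auction_state_def
    by (auto simp: le_SucI)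
qed

lemma perfect_matching_if_all_assigned:
  assumes state: "auction_state n E {0..<n} price owner"
  shows "perfect_matching n E"
proof -
  have owned: "\<And>j i. owner j = Some i \<Longrightarrow> j < n \<and> E i j"
    and inj: "\<And>j j' i. owner j = Some i \<Longrightarrow> owner j' = Some i \<Longrightarrow> j = j'"
    and ran: "ran owner = {0..<n}"
    using state by (auto simp: auction_state_def)
  have "\<forall>i\<in>{0..<n}. \<exists>j. owner j = Some i" using ran unfolding ran_def by blast
  then obtain f where f: "\<And>i. i < n \<Longrightarrow> owner (f i) = Some i" by (metis atLeastLessThan_iff zero_le)
  have "inj_on f {0..<n}" by (rule inj_onI) (metis f atLeastLessThan_iff option.inject)
  moreover have "f ` {0..<n} \<subseteq> {0..<n}" using f owned by fastforce
  ultimately have "bij_betw f {0..<n} {0..<n}"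
    by (simp add: bij_betw_def endo_inj_surj)
  then have "restrict_id f {0..<n} permutes {0..<n}" by (rule permutes_restrict_id)
  moreover have "\<forall>i<n. E i (restrict_id f {0..<n} i)" using f owned by auto
  ultimately show ?thesis unfolding perfect_matching_def by blast
qed

text \<open>The price total measures progress: it is bounded, and by the next lemma each bid adds
  one.\<close>

lemma auction_price_sum_le:
  "auction_state n E S price owner \<Longrightarrow> (\<Sum>j<n. price j) \<le> n * n"
  using sum_bounded_above[of "{..<n}" price n] by (auto simp: auction_state_def)

lemma auction_price_sum_bid:
  "b < n \<Longrightarrow> (\<Sum>j<n. (price(b := Suc (price b))) j) = Suc (\<Sum>j<n. price j)"
  for price :: "nat \<Rightarrow> nat"
  by (simp add: sum.remove[of "{..<n}" b] cong: sum.cong_simp)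

text \<open>Hall's theorem by playing the auction from the empty assignment: a state is complete, or
  stuck, or admits a bid that raises the bounded price total.\<close>

theorem perfect_matching_or_hall_violation: "perfect_matching n E \<or> hall_violation n E"
proof -
  have "perfect_matching n E \<or> hall_violation n E"
    if "auction_state n E S price owner" for S price owner
    using that
  proof (induction "n * n - (\<Sum>j<n. price j)" arbitrary: S price owner rule: less_induct)
    case less
    show ?case
    proof (cases "S = {0..<n}")
      case True
      then show ?thesis using less.prems perfect_matching_if_all_assigned by blast
    next
      case False
      then obtain c where c: "c < n" "c \<notin> S"
        using less.prems unfolding auction_state_def
        by (metis atLeastLessThan_iff subsetI subset_antisym zero_le)
      show ?thesis
      proof (cases "\<forall>k<n. E c k \<longrightarrow> n \<le> price k")
        case True
        then show ?thesis using hall_violation_if_stuck[OF less.prems c] by blast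
      next
        case False
        then obtain k where k: "k < n \<and> E c k" "price k < n" by auto
        obtain b where b: "b < n \<and> E c b" "\<And>k. k < n \<and> E c k \<Longrightarrow> price b \<le> price k"
          using ex_has_least_nat[of "\<lambda>k. k < n \<and> E c k" k price] k(1) by metis
        have "price b < n" using b(2)[OF k(1)] k(2) by simp
        then have bid: "auction_state n E (insert c (S - set_option (owner b)))
            (price(b := Suc (price b))) (owner(b \<mapsto> c))"
          using auction_state_bid[OF less.prems c] b by blast
        show ?thesis
          using less.hyps[OF _ bid] auction_price_sum_le[OF bid] b(1)
          by (simp only: auction_price_sum_bid)
      qed
    qed
  qed
  then show ?thesis using auction_state_init by blast
qed

subsection \<open>Perfect 2-matchings of the support graph\<close>

text \<open>Neighbours \<open>v\<close> of \<open>u\<close>, including \<open>u\<close> itself for a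
  loop, correspond one to one to incident edges. This turns incidence sums into row sums.\<close>

lemma sum_incident_support_graph:
  assumes M: "M \<in> carrier_mat n n" and sym: "sym_mat M" and u: "u < n"
  shows "(\<Sum>e\<in>incident (support_graph M) u. x e) =
    (\<Sum>v = 0..<n. if M $$ (u, v) \<noteq> 0 then x {u, v} else (0::nat))"
proof -
  let ?V = "{v \<in> {0..<n}. M $$ (u, v) \<noteq> 0}"
  have "incident (support_graph M) u = (\<lambda>v. {u, v}) ` ?V"
  proof (intro equalityI subsetI)
    fix e assume "e \<in> incident (support_graph M) u"
    then obtain a b where ab: "e = {a, b}" "a < n" "b < n" "M $$ (a, b) \<noteq> 0" "u \<in> e"
      using M by (auto simp: incident_def support_graph_def)
    then show "e \<in> (\<lambda>v. {u, v}) ` ?V"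
      using sym_matD[OF sym M, of a b] by (auto simp: insert_commute)
  next
    fix e assume "e \<in> (\<lambda>v. {u, v}) ` ?V"
    then show "e \<in> incident (support_graph M) u"
      using M u by (auto simp: incident_def support_graph_def)
  qed
  moreover have "inj_on (\<lambda>v. {u, v}) ?V" by (auto simp: inj_on_def doubleton_eq_iff)
  ultimately have "(\<Sum>e\<in>incident (support_graph M) u. x e) = (\<Sum>v\<in>?V. x {u, v})"
    by (simp add: sum.reindex)
  also have "\<dots> = (\<Sum>v = 0..<n. if M $$ (u, v) \<noteq> 0 then x {u, v} else 0)"
    by (simp add: sum.inter_filter[symmetric])
  finally show ?thesis .
qed

lemma perfect_2_matching_if_perfect_matching:
  assumes M: "M \<in> carrier_mat n n" and sym: "sym_mat M"
    and pm: "perfect_matching n (\<lambda>i j. M $$ (i, j) \<noteq> 0)"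
  shows "\<exists>x. perfect_2_matching (support_graph M) x"
proof -
  obtain p where p: "p permutes {0..<n}" "\<And>i. i < n \<Longrightarrow> M $$ (i, p i) \<noteq> 0"
    using pm by (auto simp: perfect_matching_def)
  \<comment> \<open>A loop occurs once in the sum at its vertex, so a fixed point has to give it
    value 2.\<close>
  define x where "x e = (if is_singleton e then 2 else 1) * edge_mult n p e" for e
  have x: "x {u, v} = of_bool (p u = v) + of_bool (p v = u)" if "u < n" "v < n" for u v
    using that by (cases "u = v") (auto simp: x_def edge_mult_loop edge_mult_edge is_singleton_def
        doubleton_eq_iff singleton_insert_inj_eq)
  have pin: "p u < n \<longleftrightarrow> u < n" for u using permutes_in_image[OF p(1), of u] by simp
  define q where "q = inv_into UNIV p"
  have q: "p v = u \<longleftrightarrow> q u = v" "p (q u) = u" for u v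
    using permutes_inverses[OF p(1)] unfolding q_def by metis+
  have "(\<Sum>e\<in>incident (support_graph M) u. x e) = 2" if u: "u < n" for u
  proof -
    \<comment> \<open>Where either indicator is 1 the entry is nonzero, in the second case by
      symmetry of \<open>M\<close>, so the support condition removes nothing.\<close>
    have "(if M $$ (u, v) \<noteq> 0 then x {u, v} else 0) =
        (if p u = v then 1 else 0) + (if q u = v then 1 else 0)" if "v < n" for v
      using x[OF u that] p(2)[OF u] p(2)[OF that] sym_matD[OF sym M u that] q(1)[of v u] by auto
    then have "(\<Sum>e\<in>incident (support_graph M) u. x e) =
        (\<Sum>v = 0..<n. if p u = v then 1 else 0) + (\<Sum>v = 0..<n. if q u = v then 1 else 0)"
      unfolding sum_incident_support_graph[OF M sym u] by (simp add: sum.distrib)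
    moreover have "q u < n" using u pin q(2) by metis
    ultimately show ?thesis using u pin by simp
  qed
  moreover have "x e \<in> {0, 1, 2}" if "e \<in> snd (support_graph M)" for e
  proof -
    obtain u v where "e = {u, v}" "u < n" "v < n" using \<open>e \<in> _\<close> M by (auto simp: support_graph_def)
    then show ?thesis using x by auto
  qed
  ultimately show ?thesis
    using M by (auto simp: perfect_2_matching_def support_graph_def)
qed

text \<open>The values on the edges form a symmetric matrix with row sums 2. In a Hall violation the
  rows in \<open>X\<close> have total weight \<open>2 * card X\<close>, all of it in the columns
  \<open>T\<close>, whose total is only \<open>2 * card T\<close>.\<close>

lemma perfect_matching_if_perfect_2_matching:
  assumes M: "M \<in> carrier_mat n n" and sym: "sym_mat M"
    and x: "perfect_2_matching (support_graph M) x"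
  shows "perfect_matching n (\<lambda>i j. M $$ (i, j) \<noteq> 0)"
proof (rule ccontr)
  assume "\<not> ?thesis"
  then have "hall_violation n (\<lambda>i j. M $$ (i, j) \<noteq> 0)"
    using perfect_matching_or_hall_violation by blast
  then obtain X T where XT: "X \<subseteq> {0..<n}" "T \<subseteq> {0..<n}" "card T < card X"
      "\<And>i j. i \<in> X \<Longrightarrow> j < n \<Longrightarrow> M $$ (i, j) \<noteq> 0 \<Longrightarrow> j \<in> T"
    unfolding hall_violation_def by metis
  define a where "a u v = (if M $$ (u, v) \<noteq> 0 then x {u, v} else 0)" for u v
  have row: "(\<Sum>v = 0..<n. a u v) = 2" if "u < n" for u
    using x that M sum_incident_support_graph[OF M sym that, of x]
    by (simp add: perfect_2_matching_def support_graph_def a_def)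
  have a_sym: "a u v = a v u" if "u < n" "v < n" for u v
    using sym_matD[OF sym M that] by (simp add: a_def insert_commute)
  have "2 * card X = (\<Sum>u\<in>X. \<Sum>v = 0..<n. a u v)"
    using row XT(1) by (subst sum.cong[OF refl, of X _ "\<lambda>_. 2"]) auto
  also have "\<dots> = (\<Sum>u\<in>X. \<Sum>v\<in>T. a u v)"
    by (intro sum.cong refl sum.mono_neutral_right) (use XT in \<open>auto simp: a_def\<close>)
  also have "\<dots> = (\<Sum>v\<in>T. \<Sum>u\<in>X. a u v)" by (rule sum.swap)
  also have "\<dots> \<le> (\<Sum>v\<in>T. \<Sum>u = 0..<n. a u v)"
    by (intro sum_mono sum_mono2) (use XT in auto)
  also have "\<dots> = (\<Sum>v\<in>T. \<Sum>u = 0..<n. a v u)"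
    by (intro sum.cong refl a_sym) (use XT in auto)
  also have "\<dots> = 2 * card T"
    using row XT(2) by (subst sum.cong[OF refl, of T _ "\<lambda>_. 2"]) auto
  finally show False using XT(3) by simp
qed

subsection \<open>Terminating runs with bounded register contents\<close>

definition mem_ok :: "real set \<Rightarrow> state \<Rightarrow> bool" where
  "mem_ok V s \<longleftrightarrow> (\<forall>pc R. s = Running pc R \<longrightarrow> range R \<subseteq> V)"

text \<open>Here \<open>t\<close> is an upper bound on the time, and confinement to \<open>V\<close>
  is what later bounds the logarithmic cost. The start memory is assumed, not asserted, to lie in
  \<open>V\<close>, so in backward chaining each rule checks only the value just written.\<close>

definition halts :: "instr list \<Rightarrow> real set \<Rightarrow> bool \<Rightarrow> nat \<Rightarrow> state \<Rightarrow> bool" where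
  "halts P V b t s \<longleftrightarrow> (mem_ok V s \<longrightarrow>
    (\<exists>k\<le>t. (step P ^^ k) s = Halted b \<and> (\<forall>m<k. mem_ok V ((step P ^^ m) s))))"

lemma halts_mono: "halts P V b t s \<Longrightarrow> t \<le> t' \<Longrightarrow> halts P V b t' s"
  unfolding halts_def by (meson le_trans)

lemma halts_step:
  assumes "pc < length P" "range R \<subseteq> V \<Longrightarrow> mem_ok V (exec (P ! pc) pc R)"
    and "halts P V b t (exec (P ! pc) pc R)"
  shows "halts P V b (Suc t) (Running pc R)"
  unfolding halts_def
proof
  assume ok: "mem_ok V (Running pc R)"
  then have "mem_ok V (exec (P ! pc) pc R)" using assms(2) by (simp add: mem_ok_def)
  then obtain k where k: "k \<le> t" "(step P ^^ k) (exec (P ! pc) pc R) = Halted b"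
      "\<And>m. m < k \<Longrightarrow> mem_ok V ((step P ^^ m) (exec (P ! pc) pc R))"
    using assms(3) unfolding halts_def by blast
  have shift: "(step P ^^ Suc m) (Running pc R) = (step P ^^ m) (exec (P ! pc) pc R)" for m
    using assms(1) by (simp add: funpow_Suc_right del: funpow.simps)
  have "mem_ok V ((step P ^^ m) (Running pc R))" if "m < Suc k" for m
    using that ok k(3) shift by (cases m) (auto simp del: funpow.simps(2))
  then show "\<exists>k\<le>Suc t. (step P ^^ k) (Running pc R) = Halted b \<and>
      (\<forall>m<k. mem_ok V ((step P ^^ m) (Running pc R)))"
    using k shift by (intro exI[of _ "Suc k"]) (simp del: funpow.simps)
qed

text \<open>Premises such as \<open>t - 1 = t'\<close> and \<open>Suc pc = pc'\<close> let the
  simplifier compute the next time bound and program counter during symbolic execution.\<close>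

lemma halts_write:
  assumes "P ! pc = i" "pc < length P" "0 < t" "t - 1 = t'" "Suc pc = pc'"
    and "exec i pc R = Running (Suc pc) (R(r := x))" "x \<in> V"
    and "halts P V b t' (Running pc' (R(r := x)))"
  shows "halts P V b t (Running pc R)"
  using halts_step[of pc P R V b t'] assms by (fastforce simp: mem_ok_def)

lemma halts_goto:
  assumes "P ! pc = i" "pc < length P" "0 < t" "t - 1 = t'"
    and "exec i pc R = Running pc' R" "halts P V b t' (Running pc' R)"
  shows "halts P V b t (Running pc R)"
  using halts_step[of pc P R V b t'] assms by (fastforce simp: mem_ok_def)

lemma halts_Const:
  assumes "P ! pc = Const r z" "pc < length P" "0 < t" "t - 1 = t'" "Suc pc = pc'"
    and "of_int z = x" "x \<in> V" "halts P V b t' (Running pc' (R(r := x)))"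
  shows "halts P V b t (Running pc R)"
  using assms by (intro halts_write[OF assms(1-5)]) auto

lemma halts_Add:
  assumes "P ! pc = Add r u v" "pc < length P" "0 < t" "t - 1 = t'" "Suc pc = pc'"
    and "R u + R v = x" "x \<in> V" "halts P V b t' (Running pc' (R(r := x)))"
  shows "halts P V b t (Running pc R)"
  using assms by (intro halts_write[OF assms(1-5)]) auto

lemma halts_Sub:
  assumes "P ! pc = Sub r u v" "pc < length P" "0 < t" "t - 1 = t'" "Suc pc = pc'"
    and "R u - R v = x" "x \<in> V" "halts P V b t' (Running pc' (R(r := x)))"
  shows "halts P V b t (Running pc R)"
  using assms by (intro halts_write[OF assms(1-5)]) auto

lemma halts_Mul:
  assumes "P ! pc = Mul r u v" "pc < length P" "0 < t" "t - 1 = t'" "Suc pc = pc'"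
    and "R u * R v = x" "x \<in> V" "halts P V b t' (Running pc' (R(r := x)))"
  shows "halts P V b t (Running pc R)"
  using assms by (intro halts_write[OF assms(1-5)]) auto

text \<open>A loaded value already sits in a register, so its membership in \<open>V\<close> comes
  for free.\<close>

lemma halts_Load:
  assumes "P ! pc = Load r u" "pc < length P" "0 < t" "t - 1 = t'" "Suc pc = pc'"
    and "R u = real k" "R k = x" "halts P V b t' (Running pc' (R(r := x)))"
  shows "halts P V b t (Running pc R)"
proof -
  have "exec (P ! pc) pc R = Running pc' (R(r := x))"
    using assms by (simp add: reg_index_def)
  then show ?thesis
    using halts_step[of pc P R V b t'] assms by (fastforce simp: mem_ok_def)
qed

lemma halts_Store:
  assumes "P ! pc = Store r u" "pc < length P" "0 < t" "t - 1 = t'" "Suc pc = pc'"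
    and "R r = real k" "R u = x" "halts P V b t' (Running pc' (R(k := x)))"
  shows "halts P V b t (Running pc R)"
proof -
  have "exec (P ! pc) pc R = Running pc' (R(k := x))"
    using assms by (simp add: reg_index_def)
  then show ?thesis
    using halts_step[of pc P R V b t'] assms by (fastforce simp: mem_ok_def)
qed

lemma halts_Jump:
  assumes "P ! pc = Jump l" "pc < length P" "0 < t" "t - 1 = t'"
    and "halts P V b t' (Running l R)"
  shows "halts P V b t (Running pc R)"
  using assms by (intro halts_goto[OF assms(1-4)]) auto

lemma halts_Jump_Zero:
  assumes "P ! pc = Jump_Zero r l" "pc < length P" "0 < t" "t - 1 = t'" "Suc pc = pc'"
    and "R r = 0 \<Longrightarrow> halts P V b t' (Running l R)" "R r \<noteq> 0 \<Longrightarrow> halts P V b t' (Running pc' R)"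
  shows "halts P V b t (Running pc R)"
  using assms by (cases "R r = 0") (auto intro: halts_goto[OF assms(1-4)])

lemma halts_Jump_Pos:
  assumes "P ! pc = Jump_Pos r l" "pc < length P" "0 < t" "t - 1 = t'" "Suc pc = pc'"
    and "R r > 0 \<Longrightarrow> halts P V b t' (Running l R)" "\<not> R r > 0 \<Longrightarrow> halts P V b t' (Running pc' R)"
  shows "halts P V b t (Running pc R)"
  using assms by (cases "R r > 0") (auto intro: halts_goto[OF assms(1-4)])

lemma halts_Halt:
  assumes "P ! pc = Halt b" "pc < length P" "0 < t"
  shows "halts P V b t (Running pc R)"
proof -
  have "halts P V b (t - 1) (Halted b)" unfolding halts_def by (auto intro!: exI[of _ 0])
  then show ?thesis
    using halts_step[of pc P R V b "t - 1"] assms by (simp add: mem_ok_def)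
qed

lemma log_cost_le:
  assumes cost: "\<And>i R. i \<in> set P \<Longrightarrow> range R \<subseteq> V \<Longrightarrow> instr_cost i R \<le> c"
    and ok: "\<And>m. m < k \<Longrightarrow> mem_ok V (run P M m)"
  shows "log_cost P M k \<le> k * c"
proof -
  have "state_cost P (run P M m) \<le> c" if "m < k" for m
    using ok[OF that] cost by (cases "run P M m") (auto simp: mem_ok_def)
  then show ?thesis
    unfolding log_cost_def using sum_bounded_above[of "{..<k}" _ c] by fastforce
qed

subsection \<open>The auction on the machine\<close>

text \<open>
  The input occupies the low registers, so registers 2 to 9 are first moved to \<open>D + 2, \<dots>, D + 9\<close>
  with \<open>D + 2 = (n + 10)\<^sup>2\<close>. Register 1 is needed for this very computation; only its being zero
  matters, and this is remembered by branching (first and second block below) and stored at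
  \<open>D + 1\<close>. Afterwards the registers \<open>0, \<dots>, 9\<close> contain \<open>n\<close>, \<open>D\<close>, 1, the best price, the object
  being scanned, the best object, the bidding person, two temporaries and the number of persons
  yet to enter. Objects are numbered from 1, persons are represented by multiples of \<open>n\<close>. The
  prices and owners of the objects are kept behind \<open>2 * D\<close> and \<open>3 * D\<close>, an owner 0 meaning none.
\<close>

definition matching_program :: "instr list" where
  "matching_program = [
    Jump_Zero 0 77,
    Jump_Zero 1 9, Const 1 10, Add 0 0 1, Mul 1 0 0, Store 1 2, Const 2 1, Sub 1 1 2, Jump 16,
    Const 1 10, Add 0 0 1, Mul 1 0 0, Store 1 2, Const 2 1, Sub 1 1 2, Const 2 0,
    Store 1 2, Const 2 1, Add 1 1 2, Add 1 1 2, Store 1 3, Add 1 1 2, Store 1 4, Add 1 1 2,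
    Store 1 5, Add 1 1 2, Store 1 6, Add 1 1 2, Store 1 7, Add 1 1 2, Store 1 8, Add 1 1 2,
    Store 1 9, Const 3 9, Sub 1 1 3, Const 3 10, Sub 0 0 3, Mul 9 0 0,
    Jump_Zero 9 77, Sub 9 9 0, Add 6 9 0,
    Const 7 0, Add 3 0 7, Add 4 0 7,
    Jump_Zero 4 64, Add 8 6 4, Sub 8 8 0, Const 7 9, Sub 7 8 7, Jump_Pos 7 51, Add 8 8 1,
    Load 7 8, Jump_Zero 7 62, Add 8 1 1, Add 8 8 4, Load 7 8, Sub 7 3 7, Jump_Pos 7 59, Jump 62,
    Sub 3 3 7, Const 7 0, Add 5 4 7,
    Sub 4 4 2, Jump 44,
    Sub 7 0 3, Jump_Zero 7 78, Add 8 1 1, Add 8 8 5, Add 3 3 2, Store 8 3, Add 8 8 1, Load 7 8,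
    Store 8 6, Jump_Zero 7 38, Const 4 0, Add 6 7 4, Jump 41,
    Halt False, Halt True]"

lemma length_matching_program: "length matching_program = 79"
  by (simp add: matching_program_def)

text \<open>Facts are counted from 1 and instructions from 0, so the fact cited for program counter
  \<open>k\<close> is number \<open>k + 1\<close>.\<close>

lemma matching_program_nth:
  "matching_program ! 0 = Jump_Zero 0 77"
  "matching_program ! 1 = Jump_Zero 1 9"
  "matching_program ! 2 = Const 1 10"
  "matching_program ! 3 = Add 0 0 1"
  "matching_program ! 4 = Mul 1 0 0"
  "matching_program ! 5 = Store 1 2"
  "matching_program ! 6 = Const 2 1"
  "matching_program ! 7 = Sub 1 1 2"
  "matching_program ! 8 = Jump 16"
  "matching_program ! 9 = Const 1 10"
  "matching_program ! 10 = Add 0 0 1"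
  "matching_program ! 11 = Mul 1 0 0"
  "matching_program ! 12 = Store 1 2"
  "matching_program ! 13 = Const 2 1"
  "matching_program ! 14 = Sub 1 1 2"
  "matching_program ! 15 = Const 2 0"
  "matching_program ! 16 = Store 1 2"
  "matching_program ! 17 = Const 2 1"
  "matching_program ! 18 = Add 1 1 2"
  "matching_program ! 19 = Add 1 1 2"
  "matching_program ! 20 = Store 1 3"
  "matching_program ! 21 = Add 1 1 2"
  "matching_program ! 22 = Store 1 4"
  "matching_program ! 23 = Add 1 1 2"
  "matching_program ! 24 = Store 1 5"
  "matching_program ! 25 = Add 1 1 2"
  "matching_program ! 26 = Store 1 6"
  "matching_program ! 27 = Add 1 1 2"
  "matching_program ! 28 = Store 1 7"
  "matching_program ! 29 = Add 1 1 2"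
  "matching_program ! 30 = Store 1 8"
  "matching_program ! 31 = Add 1 1 2"
  "matching_program ! 32 = Store 1 9"
  "matching_program ! 33 = Const 3 9"
  "matching_program ! 34 = Sub 1 1 3"
  "matching_program ! 35 = Const 3 10"
  "matching_program ! 36 = Sub 0 0 3"
  "matching_program ! 37 = Mul 9 0 0"
  "matching_program ! 38 = Jump_Zero 9 77"
  "matching_program ! 39 = Sub 9 9 0"
  "matching_program ! 40 = Add 6 9 0"
  "matching_program ! 41 = Const 7 0"
  "matching_program ! 42 = Add 3 0 7"
  "matching_program ! 43 = Add 4 0 7"
  "matching_program ! 44 = Jump_Zero 4 64"
  "matching_program ! 45 = Add 8 6 4"
  "matching_program ! 46 = Sub 8 8 0"
  "matching_program ! 47 = Const 7 9"
  "matching_program ! 48 = Sub 7 8 7"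
  "matching_program ! 49 = Jump_Pos 7 51"
  "matching_program ! 50 = Add 8 8 1"
  "matching_program ! 51 = Load 7 8"
  "matching_program ! 52 = Jump_Zero 7 62"
  "matching_program ! 53 = Add 8 1 1"
  "matching_program ! 54 = Add 8 8 4"
  "matching_program ! 55 = Load 7 8"
  "matching_program ! 56 = Sub 7 3 7"
  "matching_program ! 57 = Jump_Pos 7 59"
  "matching_program ! 58 = Jump 62"
  "matching_program ! 59 = Sub 3 3 7"
  "matching_program ! 60 = Const 7 0"
  "matching_program ! 61 = Add 5 4 7"
  "matching_program ! 62 = Sub 4 4 2"
  "matching_program ! 63 = Jump 44"
  "matching_program ! 64 = Sub 7 0 3"
  "matching_program ! 65 = Jump_Zero 7 78"
  "matching_program ! 66 = Add 8 1 1"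
  "matching_program ! 67 = Add 8 8 5"
  "matching_program ! 68 = Add 3 3 2"
  "matching_program ! 69 = Store 8 3"
  "matching_program ! 70 = Add 8 8 1"
  "matching_program ! 71 = Load 7 8"
  "matching_program ! 72 = Store 8 6"
  "matching_program ! 73 = Jump_Zero 7 38"
  "matching_program ! 74 = Const 4 0"
  "matching_program ! 75 = Add 6 7 4"
  "matching_program ! 76 = Jump 41"
  "matching_program ! 77 = Halt False"
  "matching_program ! 78 = Halt True"
  by (simp_all add: matching_program_def)

declare length_matching_program [simp]

section \<open>Memory layout and invariants of the machine\<close>

locale matching_machine =
  fixes n :: nat and M :: "real mat" and ans :: bool
  assumes M: "M \<in> carrier_mat n n"
    and ans: "ans \<longleftrightarrow> \<not> perfect_matching n (\<lambda>i j. M $$ (i, j) \<noteq> 0)"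
begin

text \<open>This is \<open>(n + 10)\<^sup>2 - 2\<close>: a square can be computed with registers 0
  and 1 alone, and it exceeds both the input addresses and the working registers.\<close>

definition D :: nat where "D = n * n + 20 * n + 98"

text \<open>Owner addresses \<open>3 * D + Suc j\<close> stay below \<open>4 * D\<close>; negative
  integers arise when a comparison subtracts.\<close>

definition V :: "real set" where
  "V = {real_of_int z | z. \<bar>z\<bar> \<le> int (4 * D)} \<union> {M $$ (i, j) | i j. i < n \<and> j < n}"

abbreviation adj :: "nat \<Rightarrow> nat \<Rightarrow> bool" where "adj i j \<equiv> M $$ (i, j) \<noteq> 0"

abbreviation halts_within :: "nat \<Rightarrow> nat \<Rightarrow> memory \<Rightarrow> bool" where
  "halts_within t pc R \<equiv> halts matching_program V ans t (Running pc R)"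

text \<open>The place of the entry from input register \<open>k\<close> once the working registers
  have been vacated.\<close>

definition loc :: "nat \<Rightarrow> nat" where
  "loc k = (if 9 < k then k else D + k)"

text \<open>Entries are known only up to being zero. The code \<open>Suc i * n\<close> of a person
  is positive, leaving 0 for no owner, and adding an object number and subtracting \<open>n\<close>
  yields the input position of an entry without a multiplication.\<close>

definition main_mem :: "memory \<Rightarrow> (nat \<Rightarrow> nat) \<Rightarrow> (nat \<rightharpoonup> nat) \<Rightarrow> nat \<Rightarrow> bool" where
  "main_mem R price owner r \<longleftrightarrow> R 0 = real n \<and> R 1 = real D \<and> R 2 = 1 \<and> R 9 = real (r * n) \<and>
    (\<forall>i<n. \<forall>j<n. R (loc (i * n + Suc j)) \<noteq> 0 \<longleftrightarrow> adj i j) \<and>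
    (\<forall>j<n. R (2 * D + Suc j) = real (price j)) \<and>
    (\<forall>j<n. R (3 * D + Suc j) = real (case owner j of None \<Rightarrow> 0 | Some i \<Rightarrow> Suc i * n))"

text \<open>Registers 5 and 3 hold the cheapest object found so far and its price, or the latter is \<open>n\<close>.\<close>

definition scan_mem :: "memory \<Rightarrow> (nat \<Rightarrow> nat) \<Rightarrow> nat \<Rightarrow> nat \<Rightarrow> nat \<Rightarrow> bool" where
  "scan_mem R price c m bp \<longleftrightarrow> R 6 = real (Suc c * n) \<and> R 3 = real bp \<and> bp \<le> n \<and>
    (bp < n \<longrightarrow> (\<exists>b<n. R 5 = real (Suc b) \<and> adj c b \<and> price b = bp)) \<and>
    (\<forall>k<n. m \<le> k \<longrightarrow> adj c k \<longrightarrow> bp \<le> price k)"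

lemma V_int: "x = real_of_int z \<Longrightarrow> \<bar>z\<bar> \<le> int (4 * D) \<Longrightarrow> x \<in> V"
  unfolding V_def by blast

lemma V_nat: "k \<le> 4 * D \<Longrightarrow> real k \<in> V"
  by (rule V_int[of _ "int k"]) auto

lemma V_diff: "k \<le> 4 * D \<Longrightarrow> l \<le> 4 * D \<Longrightarrow> real k - real l \<in> V"
  by (rule V_int[of _ "int k - int l"]) auto

lemmas step_Const = halts_Const[OF _ _ _ _ _ _ V_nat]
  and step_Add = halts_Add[OF _ _ _ _ _ _ V_nat]
  and step_Sub = halts_Sub[OF _ _ _ _ _ _ V_nat]
  and step_Sub_signed = halts_Sub[OF _ _ _ _ _ _ V_diff]
  and step_Mul = halts_Mul[OF _ _ _ _ _ _ V_nat]

lemma D_ge: "98 \<le> D" "n < D" "n * n < D"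
  by (auto simp: D_def)

lemma loc_ge: "10 \<le> loc k" using D_ge(1) by (auto simp: loc_def)

lemma entry_le: "i < n \<Longrightarrow> j < n \<Longrightarrow> i * n + Suc j \<le> n * n"
proof -
  assume "i < n" "j < n"
  then have "i * n + Suc j \<le> i * n + n" by simp
  also have "\<dots> = Suc i * n" by simp
  also have "\<dots> \<le> n * n" using \<open>i < n\<close> by (intro mult_right_mono) auto
  finally show ?thesis .
qed

lemma loc_less: "i < n \<Longrightarrow> j < n \<Longrightarrow> loc (i * n + Suc j) < 2 * D"
  using entry_le[of i j] D_ge by (auto simp: loc_def)

lemma main_mem_scalar [simp]:
  assumes "k \<in> {3..8}"
  shows "main_mem (R(k := x)) price owner r \<longleftrightarrow> main_mem R price owner r"
proof -
  have "loc l \<noteq> k" "2 * D + Suc j \<noteq> k" "3 * D + Suc j \<noteq> k" for l j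
    using loc_ge[of l] D_ge assms by auto
  then show ?thesis using assms by (auto simp: main_mem_def)
qed

lemma scan_mem_scalar [simp]:
  "k \<notin> {3, 5, 6} \<Longrightarrow> scan_mem (R(k := x)) price c m bp \<longleftrightarrow> scan_mem R price c m bp"
  by (simp add: scan_mem_def)

lemma main_memD:
  assumes "main_mem R price owner r"
  shows "R 0 = real n" "R 1 = real D" "R (Suc 0) = real D" "R 2 = 1" "R 9 = real (r * n)"
    "\<And>i j. i < n \<Longrightarrow> j < n \<Longrightarrow> R (loc (i * n + Suc j)) \<noteq> 0 \<longleftrightarrow> adj i j"
    "\<And>j. j < n \<Longrightarrow> R (2 * D + Suc j) = real (price j)"
    "\<And>j. j < n \<Longrightarrow> R (3 * D + Suc j) = real (case owner j of None \<Rightarrow> 0 | Some i \<Rightarrow> Suc i * n)"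
  using assms by (auto simp: main_mem_def)

section \<open>Scanning for the cheapest adjacent object\<close>

lemma scan_next:
  assumes main: "main_mem R price owner r" and scan: "scan_mem R price c m bp"
    and R: "R 4 = real (Suc m)" "m < n"
    and cont: "\<And>R bp. main_mem R price owner r \<Longrightarrow> scan_mem R price c m bp \<Longrightarrow> R 4 = real m \<Longrightarrow>
      halts_within t 44 R"
  shows "halts_within (t + 2) 62 R"
proof -
  note facts = main_memD(1-5)[OF main] D_ge R
  show ?thesis
    apply (rule step_Sub[OF matching_program_nth(63), where k = m]; (use facts in \<open>simp; fail\<close>)?)
    apply (rule halts_Jump[OF matching_program_nth(64)]; (use facts in \<open>simp; fail\<close>)?)
    by (rule cont[of _ bp]) (use main scan in auto)
qed

text \<open>Continuation style: \<open>cont\<close> promises termination from the loop head for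
  every memory meeting the invariant, so time bounds add up backwards. The best object is replaced
  only by an adjacent and strictly cheaper one.\<close>

lemma scan_lookup:
  assumes main: "main_mem R price owner r" and scan: "scan_mem R price c (Suc m) bp"
    and R: "R 4 = real (Suc m)" "R 8 = real (loc (c * n + Suc m))"
    and bounds: "m < n" "c < n" "\<And>j. j < n \<Longrightarrow> price j \<le> n"
    and cont: "\<And>R bp. main_mem R price owner r \<Longrightarrow> scan_mem R price c m bp \<Longrightarrow> R 4 = real m \<Longrightarrow>
      halts_within t 44 R"
  shows "halts_within (t + 13) 51 R"
proof -
  have next_unchanged: "halts_within (k + t) 62 R'"
    if "2 \<le> k" "main_mem R' price owner r" "scan_mem R' price c (Suc m) bp" "R' 4 = real (Suc m)"
      "adj c m \<Longrightarrow> bp \<le> price m" for R' k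
  proof -
    have "scan_mem R' price c m bp"
      using that unfolding scan_mem_def by (metis Suc_leI le_neq_implies_less)
    then have "halts_within (t + 2) 62 R'"
      by (rule scan_next[OF that(2) _ that(4) bounds(1)]) (rule cont)
    then show ?thesis by (rule halts_mono) (use that(1) in simp)
  qed
  have scanD: "bp \<le> n" "R 3 = real bp" "R 6 = real (Suc c * n)"
    "\<And>k. k < n \<Longrightarrow> Suc m \<le> k \<Longrightarrow> adj c k \<Longrightarrow> bp \<le> price k"
    using scan by (auto simp: scan_mem_def)
  have next_changed: "halts_within (k + t) 62 R'"
    if "2 \<le> k" "main_mem R' price owner r" "R' 3 = real (price m)" "R' 4 = real (Suc m)"
      "R' 5 = real (Suc m)" "R' 6 = R 6" "adj c m" "price m < bp" for R' k
  proof -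
    have "price m \<le> price k" if "k < n" "m \<le> k" "adj c k" for k
      using scanD(4)[of k] that \<open>price m < bp\<close> by (cases "k = m") auto
    then have "scan_mem R' price c m (price m)"
      using that scanD(1,3) bounds(1) unfolding scan_mem_def by auto
    then have "halts_within (t + 2) 62 R'"
      by (rule scan_next[OF that(2) _ that(4) bounds(1)]) (rule cont)
    then show ?thesis by (rule halts_mono) (use that(1) in simp)
  qed
  have entry: "R (loc (Suc (c * n + m))) = 0 \<longleftrightarrow> \<not> adj c m"
    using main_memD(6)[OF main bounds(2,1)] by auto
  have price: "R (2 * D + Suc m) = real (price m)" "price m \<le> n"
    using main_memD(7)[OF main bounds(1)] bounds by auto
  note facts = main_memD(1-5)[OF main] D_ge R bounds(1,2) scanD(1-3) price
  show ?thesis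
    apply (rule halts_Load[OF matching_program_nth(52)]; (use facts in \<open>simp; fail\<close>)?)
    apply (rule halts_Jump_Zero[OF matching_program_nth(53)]; (use facts in \<open>simp; fail\<close>)?)
     apply (rule next_unchanged; use main scan entry R in simp)
    apply (rule step_Add[OF matching_program_nth(54), where k = "2 * D"]; (use facts in \<open>simp; fail\<close>)?)
    apply (rule step_Add[OF matching_program_nth(55), where k = "2 * D + Suc m"]; (use facts in \<open>simp; fail\<close>)?)
    apply (rule halts_Load[OF matching_program_nth(56), where x = "real (price m)" and k = "2 * D + Suc m"]; (use facts in \<open>simp; fail\<close>)?)
    apply (rule step_Sub_signed[OF matching_program_nth(57), where k = bp and l = "price m"]; (use facts in \<open>simp; fail\<close>)?)
    apply (rule halts_Jump_Pos[OF matching_program_nth(58)]; (use facts in \<open>simp; fail\<close>)?)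
     \<comment> \<open>Register 7 holds \<open>bp - price m\<close>, so subtracting it from register
       3 leaves the new best price. Adding a zero then copies the object number.\<close>
     apply (rule step_Sub[OF matching_program_nth(60), where k = "price m"]; (use facts in \<open>simp; fail\<close>)?)
     apply (rule step_Const[OF matching_program_nth(61), where k = 0]; (use facts in \<open>simp; fail\<close>)?)
     apply (rule step_Add[OF matching_program_nth(62), where k = "Suc m"]; (use facts in \<open>simp; fail\<close>)?)
     apply (rule next_changed; use main entry R in simp)
    apply (rule halts_Jump[OF matching_program_nth(59)]; (use facts in \<open>simp; fail\<close>)?)
    apply (rule next_unchanged; use main scan entry R in simp)
    done
qed

text \<open>Objects are scanned downwards, and with numbering from 1 register 4 reaches 0 at the
  end. Up to seven instructions locate an entry and 13 are allowed for processing it, hence 20 per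
  object; the final test costs 1.\<close>

lemma scan_loop:
  assumes "main_mem R price owner r" "scan_mem R price c m bp" "R 4 = real m"
    and bounds: "m \<le> n" "c < n" "\<And>j. j < n \<Longrightarrow> price j \<le> n"
    and exit: "\<And>R bp. main_mem R price owner r \<Longrightarrow> scan_mem R price c 0 bp \<Longrightarrow> halts_within t 64 R"
  shows "halts_within (t + 20 * m + 1) 44 R"
  using assms(1-4)
proof (induction m arbitrary: R bp)
  case 0
  note facts = 0
  show ?case
    apply (rule halts_Jump_Zero[OF matching_program_nth(45)]; (use facts in \<open>simp; fail\<close>)?)
    by (rule exit) (use facts in simp_all)
next
  case (Suc m)
  note main = Suc.prems(1) and scan = Suc.prems(2) and R = Suc.prems(3)
  have m: "m < n" using Suc.prems by simp
  have cont: "halts_within (t + 20 * m + 1) 44 R"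
    if "main_mem R price owner r" "scan_mem R price c m bp" "R 4 = real m" for R bp
    using Suc.IH[OF that] m by simp
  define e where "e = c * n + Suc m"
  have lookup: "halts_within (k + (t + 20 * m)) 51 R'" if "14 \<le> k" "main_mem R' price owner r"
      "scan_mem R' price c (Suc m) bp" "R' 4 = real (Suc m)" "R' 8 = real (loc e)" for R' k
    by (rule halts_mono[OF scan_lookup[OF that(2-5)[unfolded e_def] m bounds(2,3) cont]])
       (use that(1) in auto)
  have R6: "R 6 = real n + real e - real (Suc m)"
    using scan by (simp add: scan_mem_def e_def algebra_simps)
  have le: "e \<le> n * n" unfolding e_def using entry_le bounds(2) m .
  note facts = main_memD(1-5)[OF main] D_ge R m bounds(2) R6 le
  show ?case
    apply (rule halts_Jump_Zero[OF matching_program_nth(45)]; (use facts in \<open>simp; fail\<close>)?)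
    apply (rule step_Add[OF matching_program_nth(46), where k = "n + e"]; (use facts in \<open>simp; fail\<close>)?)
    apply (rule step_Sub[OF matching_program_nth(47), where k = e]; (use facts in \<open>simp; fail\<close>)?)
    \<comment> \<open>The comparison with 9 computes \<open>loc e\<close>: entries from positions up
      to 9 are found \<open>D\<close> registers higher.\<close>
    apply (rule step_Const[OF matching_program_nth(48), where k = 9]; (use facts in \<open>simp; fail\<close>)?)
    apply (rule step_Sub_signed[OF matching_program_nth(49), where k = e and l = 9]; (use facts in \<open>simp; fail\<close>)?)
    apply (rule halts_Jump_Pos[OF matching_program_nth(50)]; (use facts in \<open>simp; fail\<close>)?)
     apply (rule lookup; use main scan R in \<open>simp add: loc_def\<close>)
    apply (rule step_Add[OF matching_program_nth(51), where k = "D + e"]; (use facts in \<open>simp; fail\<close>)?)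
    apply (rule lookup; use main scan R in \<open>simp add: loc_def\<close>)
    done
qed

lemma scan_start:
  assumes main: "main_mem R price owner r" and R: "R 6 = real (Suc c * n)"
    and bounds: "c < n" "\<And>j. j < n \<Longrightarrow> price j \<le> n"
    and exit: "\<And>R bp. main_mem R price owner r \<Longrightarrow> scan_mem R price c 0 bp \<Longrightarrow> halts_within t 64 R"
  shows "halts_within (t + 20 * n + 4) 41 R"
proof -
  have loop: "halts_within (Suc (t + 20 * n)) 44 R'" if "main_mem R' price owner r"
    "R' 3 = real n" "R' 4 = real n" "R' 6 = real (Suc c * n)" for R'
  proof -
    \<comment> \<open>Best price \<open>n\<close> stands for no candidate, and no object has index
      at least \<open>n\<close>, so both conditions on objects are vacuous.\<close>
    have "scan_mem R' price c n n" using that by (simp add: scan_mem_def)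
    from scan_loop[OF that(1) this that(3) order_refl bounds exit]
    show ?thesis by simp
  qed
  note facts = main_memD(1-5)[OF main] D_ge R
  show ?thesis
    apply (rule step_Const[OF matching_program_nth(42), where k = 0]; (use facts in \<open>simp; fail\<close>)?)
    apply (rule step_Add[OF matching_program_nth(43), where k = n]; (use facts in \<open>simp; fail\<close>)?)
    apply (rule step_Add[OF matching_program_nth(44), where k = n]; (use facts in \<open>simp; fail\<close>)?)
    apply (rule loop; use main R in simp)
    done
qed

section \<open>Entering persons, bids and rounds\<close>

lemma new_person:
  assumes main: "main_mem R price owner r" and state: "auction_state n adj {r..<n} price owner"
    and "r \<le> n"
    and cont: "\<And>R r'. r = Suc r' \<Longrightarrow> main_mem R price owner r' \<Longrightarrow> R 6 = real (Suc r' * n) \<Longrightarrow>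
      halts_within t 41 R"
  shows "halts_within (t + 3) 38 R"
proof (cases r)
  case 0
  \<comment> \<open>Persons enter in descending order, so \<open>r = 0\<close> means that all have
    entered and are assigned; the answer is then False.\<close>
  then have "\<not> ans" using state perfect_matching_if_all_assigned ans by auto
  then have halt: "matching_program ! 77 = Halt ans" by (simp add: matching_program_nth)
  note facts = main_memD(1-5)[OF main] 0
  show ?thesis
    apply (rule halts_Jump_Zero[OF matching_program_nth(39)]; (use facts in \<open>simp; fail\<close>)?)
    by (rule halts_Halt[OF halt]) auto
next
  case (Suc r')
  have "main_mem (R(9 := real (r' * n))) price owner r'"
  proof -
    have "loc l \<noteq> 9" "2 * D + Suc j \<noteq> 9" "3 * D + Suc j \<noteq> 9" for l j
      using loc_ge[of l] D_ge by auto
    then show ?thesis using main by (simp add: main_mem_def)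
  qed
  moreover have "r' * n + n \<le> n * n"
    using \<open>r \<le> n\<close> Suc mult_le_mono1[of r n n] by simp
  moreover have "R 9 \<noteq> 0"
    unfolding main_memD(5)[OF main] of_nat_eq_0_iff using Suc \<open>r \<le> n\<close> by simp
  ultimately have facts: "main_mem (R(9 := real (r' * n))) price owner r'" "r' * n + n \<le> n * n"
      "0 < n" "n * n < D" "R 0 = real n" "R 9 = real (r' * n + n)" "R 9 \<noteq> 0"
    using main_memD(1,5)[OF main] \<open>r \<le> n\<close> D_ge Suc by (auto simp: algebra_simps)
  show ?thesis
    apply (rule halts_Jump_Zero[OF matching_program_nth(39)]; (use facts in \<open>simp; fail\<close>)?)
    apply (rule step_Sub[OF matching_program_nth(40), where k = "r' * n"]; (use facts in \<open>simp; fail\<close>)?)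
    apply (rule step_Add[OF matching_program_nth(41), where k = "r' * n + n"]; (use facts in \<open>simp; fail\<close>)?)
    apply (rule halts_mono[OF cont[OF Suc]])
    by (use facts in \<open>simp_all add: algebra_simps\<close>)
qed

lemma main_mem_scalarI:
  "main_mem R price owner r \<Longrightarrow> k \<in> {3..8} \<Longrightarrow> main_mem (R(k := x)) price owner r"
  by simp

text \<open>Entries lie below \<open>2 * D\<close>, prices between \<open>2 * D\<close> and
  \<open>3 * D\<close>, owners above, so an update in one table leaves the others intact.\<close>

lemma main_mem_price:
  assumes "main_mem R price owner r" "b < n"
  shows "main_mem (R(2 * D + Suc b := real p)) (price(b := p)) owner r"
proof -
  have "loc (i * n + Suc j) \<noteq> 2 * D + Suc b" if "i < n" "j < n" for i j
    using loc_less[OF that] by simp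
  then show ?thesis using assms D_ge by (auto simp: main_mem_def)
qed

lemma main_mem_owner:
  assumes "main_mem R price owner r" "b < n"
  shows "main_mem (R(3 * D + Suc b := real (Suc c * n))) price (owner(b \<mapsto> c)) r"
proof -
  have "loc (i * n + Suc j) \<noteq> 3 * D + Suc b" if "i < n" "j < n" for i j
    using loc_less[OF that] by simp
  moreover have "2 * D + Suc j \<noteq> 3 * D + Suc b" if "j < n" for j
    using D_ge that by simp
  ultimately show ?thesis using assms D_ge by (simp add: main_mem_def)
qed

text \<open>Best price \<open>n\<close> after a full scan means that the bidder is stuck, and the
  answer is True. Otherwise the bid either takes a free object and the next person enters, or evicts
  an owner, who bids next.\<close>

lemma bid:
  assumes main: "main_mem R price owner r" and scan: "scan_mem R price c 0 bp"
    and state: "auction_state n adj S price owner" and c: "c < n" "c \<notin> S"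
    and cont_free: "\<And>R b. b < n \<Longrightarrow> owner b = None \<Longrightarrow> auction_state n adj (insert c S)
        (price(b := Suc (price b))) (owner(b \<mapsto> c)) \<Longrightarrow>
      main_mem R (price(b := Suc (price b))) (owner(b \<mapsto> c)) r \<Longrightarrow> halts_within t 38 R"
    and cont_owned: "\<And>R b i. b < n \<Longrightarrow> owner b = Some i \<Longrightarrow> auction_state n adj (insert c (S - {i}))
        (price(b := Suc (price b))) (owner(b \<mapsto> c)) \<Longrightarrow>
      main_mem R (price(b := Suc (price b))) (owner(b \<mapsto> c)) r \<Longrightarrow> R 6 = real (Suc i * n) \<Longrightarrow>
      halts_within t 41 R"
  shows "halts_within (t + 13) 64 R"
proof (cases "bp < n")
  case False
  then have bp: "bp = n" using scan by (simp add: scan_mem_def)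
  then have "n \<le> price k" if "k < n" "adj c k" for k
    using that scan by (simp add: scan_mem_def)
  then have ans_True: "ans"
    using hall_violation_if_stuck[OF state c] no_perfect_matching_if_hall_violation ans by blast
  then have halt: "matching_program ! 78 = Halt ans" by (simp add: matching_program_nth)
  have R3: "R 3 = real n" using scan bp by (simp add: scan_mem_def)
  note facts = main_memD(1-5)[OF main] R3
  show ?thesis
    apply (rule step_Sub[OF matching_program_nth(65), where k = 0]; (use facts in \<open>simp; fail\<close>)?)
    apply (rule halts_Jump_Zero[OF matching_program_nth(66)]; (use facts in \<open>simp; fail\<close>)?)
    apply (rule halts_Halt[OF halt]; simp)
    done
next
  case True
  then obtain b where b: "b < n" "R 5 = real (Suc b)" "adj c b" "price b = bp"
      "\<And>k. k < n \<Longrightarrow> adj c k \<Longrightarrow> price b \<le> price k"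
    and R: "R 3 = real bp" "R 6 = real (Suc c * n)"
    using scan unfolding scan_mem_def by auto
  have state': "auction_state n adj (insert c (S - set_option (owner b)))
      (price(b := Suc (price b))) (owner(b \<mapsto> c))"
    using auction_state_bid[OF state c b(1,3)] True b(4,5) by blast
  define w where "w = (case owner b of None \<Rightarrow> 0 | Some i \<Rightarrow> Suc i * n)"
  have owned: "R (3 * D + Suc b) = real w"
    using main_memD(8)[OF main b(1)] by (simp add: w_def)
  have w: "w \<le> 4 * D"
  proof (cases "owner b")
    case (Some i)
    then have "i \<in> S" using state by (auto simp: auction_state_def ran_def)
    then have "Suc i \<le> n" using state by (auto simp: auction_state_def)
    then have "Suc i * n \<le> n * n" by (rule mult_le_mono1)
    then show ?thesis using D_ge(3) Some by (simp add: w_def)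
  qed (simp add: w_def)
  have finish: "halts_within (k + t) 73 R'" if "4 \<le> k"
      "main_mem R' (price(b := Suc (price b))) (owner(b \<mapsto> c)) r" "R' 7 = real w" for R' k
  proof (cases "owner b")
    case None
    have cont: "halts_within t 38 R'"
      by (rule cont_free[OF b(1) None _ that(2)]) (use state' None in simp)
    note facts = that(1,3) None
    show ?thesis
      apply (rule halts_Jump_Zero[OF matching_program_nth(74)]; (use facts in \<open>simp; fail\<close>)?)
       apply (rule halts_mono[OF cont]; use facts in simp)
      using facts by (simp add: w_def)
  next
    case (Some i)
    have cont: "halts_within t 41 R''" if "main_mem R'' (price(b := Suc (price b))) (owner(b \<mapsto> c)) r"
        "R'' 6 = real w" for R''
      by (rule cont_owned[OF b(1) Some _ that(1)]) (use state' Some that(2) in \<open>simp_all add: w_def\<close>)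
    have "w \<noteq> 0" using Some c(1) by (simp add: w_def)
    note facts = that(1,3) w this
    show ?thesis
      apply (rule halts_Jump_Zero[OF matching_program_nth(74)]; (use facts in \<open>simp; fail\<close>)?)
      apply (rule step_Const[OF matching_program_nth(75), where k = 0]; (use facts in \<open>simp; fail\<close>)?)
      apply (rule step_Add[OF matching_program_nth(76), where k = w]; (use facts in \<open>simp; fail\<close>)?)
      apply (rule halts_Jump[OF matching_program_nth(77)]; (use facts in \<open>simp; fail\<close>)?)
      apply (rule halts_mono[OF cont]; use that in simp)
      done
  qed
  note facts = main_memD(1-5)[OF main] D_ge R b(1,2) owned True
  show ?thesis
    apply (rule step_Sub[OF matching_program_nth(65), where k = "n - bp"]; (use facts in \<open>simp; fail\<close>)?)
    apply (rule halts_Jump_Zero[OF matching_program_nth(66)]; (use facts in \<open>simp; fail\<close>)?)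
    apply (rule step_Add[OF matching_program_nth(67), where k = "2 * D"]; (use facts in \<open>simp; fail\<close>)?)
    apply (rule step_Add[OF matching_program_nth(68), where k = "2 * D + Suc b"]; (use facts in \<open>simp; fail\<close>)?)
    apply (rule step_Add[OF matching_program_nth(69), where k = "Suc bp"]; (use facts in \<open>simp; fail\<close>)?)
    apply (rule halts_Store[OF matching_program_nth(70), where k = "2 * D + Suc b" and x = "real (Suc (price b))"]; (use facts in \<open>simp; fail\<close>)?)
     apply (use b(4) in simp)
    apply (rule step_Add[OF matching_program_nth(71), where k = "3 * D + Suc b"]; (use facts in \<open>simp; fail\<close>)?)
    apply (rule halts_Load[OF matching_program_nth(72), where k = "3 * D + Suc b" and x = "real w"]; (use facts in \<open>simp; fail\<close>)?)
    apply (rule halts_Store[OF matching_program_nth(73), where k = "3 * D + Suc b" and x = "real (Suc c * n)"]; (use facts in \<open>simp; fail\<close>)?)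
    apply (rule finish)
      apply simp
     apply (intro main_mem_owner main_mem_price main_mem_scalarI main b(1); simp)
    using facts by simp
qed


text \<open>Only the bidder \<open>c\<close> is unassigned among the persons who entered. A round
  costs \<open>20 * n + 4\<close> for the scan, 13 for the bid and 3 for a new person;
  \<open>Suc\<close> accounts for a last round that gets stuck.\<close>

lemma auction_rounds:
  assumes "main_mem R price owner r" "auction_state n adj ({r..<n} - {c}) price owner"
    and "c \<in> {r..<n}" "R 6 = real (Suc c * n)"
  shows "halts_within (Suc (n * n - (\<Sum>j<n. price j)) * (20 * n + 20)) 41 R"
  using assms
proof (induction "n * n - (\<Sum>j<n. price j)" arbitrary: R price owner r c rule: less_induct)
  case less
  define t where "t = (n * n - (\<Sum>j<n. price j)) * (20 * n + 20)"
  note state = less.prems(2)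
  have c: "c < n" "c \<notin> {r..<n} - {c}" using less.prems(3) by auto
  have price_le: "price j \<le> n" if "j < n" for j
    using state that by (simp add: auction_state_def)
  have IH: "halts_within t 41 R'"
    if "b < n" "auction_state n adj ({r'..<n} - {c'}) (price(b := Suc (price b))) owner'"
      "main_mem R' (price(b := Suc (price b))) owner' r'" "c' \<in> {r'..<n}" "R' 6 = real (Suc c' * n)"
    for R' b owner' r' c'
  proof -
    \<comment> \<open>The sum after the bid is still at most \<open>n * n\<close>, so the truncated
      difference really drops by one.\<close>
    have "Suc (n * n - (\<Sum>j<n. (price(b := Suc (price b))) j)) = n * n - (\<Sum>j<n. price j)"
      using auction_price_sum_le[OF that(2)] unfolding auction_price_sum_bid[OF that(1)] by simp
    then show ?thesis using less.hyps[OF _ that(3,2,4,5)] unfolding t_def by simp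
  qed
  have exit: "halts_within ((t + 3) + 13) 64 R'"
    if "main_mem R' price owner r" "scan_mem R' price c 0 bp" for R' bp
  proof (rule bid[OF that state c])
    fix R b
    assume b: "b < n" and
      state': "auction_state n adj (insert c ({r..<n} - {c})) (price(b := Suc (price b))) (owner(b \<mapsto> c))"
      and main': "main_mem R (price(b := Suc (price b))) (owner(b \<mapsto> c)) r"
    have "insert c ({r..<n} - {c}) = {r..<n}" using less.prems(3) by auto
    with state' have state'': "auction_state n adj {r..<n} (price(b := Suc (price b))) (owner(b \<mapsto> c))"
      by simp
    have r: "r \<le> n" using less.prems(3) by simp
    show "halts_within (t + 3) 38 R"
    proof (rule new_person[OF main' state'' r])
      fix R r'
      assume "r = Suc r'" and main: "main_mem R (price(b := Suc (price b))) (owner(b \<mapsto> c)) r'"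
        and R: "R 6 = real (Suc r' * n)"
      then have "{r..<n} = {r'..<n} - {r'}" by auto
      with state'' have "auction_state n adj ({r'..<n} - {r'}) (price(b := Suc (price b))) (owner(b \<mapsto> c))"
        by simp
      then show "halts_within t 41 R" using IH[OF b _ main _ R] r \<open>r = Suc r'\<close> by simp
    qed
  next
    fix R b i
    assume b: "b < n" "owner b = Some i" and
      state': "auction_state n adj (insert c ({r..<n} - {c} - {i})) (price(b := Suc (price b))) (owner(b \<mapsto> c))"
      and main': "main_mem R (price(b := Suc (price b))) (owner(b \<mapsto> c)) r"
      and R: "R 6 = real (Suc i * n)"
    have i: "i \<in> {r..<n} - {c}"
      using state b(2) unfolding auction_state_def by (metis ranI)
    then have "insert c ({r..<n} - {c} - {i}) = {r..<n} - {i}" using less.prems(3) by auto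
    with state' have "auction_state n adj ({r..<n} - {i}) (price(b := Suc (price b))) (owner(b \<mapsto> c))"
      by simp
    from IH[OF b(1) this main' _ R] i have "halts_within t 41 R" by simp
    then show "halts_within (t + 3) 41 R" by (rule halts_mono) simp
  qed
  have "halts_within (((t + 3) + 13) + 20 * n + 4) 41 R"
    using less.prems(1,4) c(1) price_le exit by (rule scan_start)
  then show ?case by (rule halts_mono) (simp add: t_def)
qed

lemma auction_start:
  assumes "main_mem R (\<lambda>_. 0) (\<lambda>_. None) n"
  shows "halts_within (Suc (n * n) * (20 * n + 20) + 3) 38 R"
proof (rule new_person[OF assms])
  show "auction_state n adj {n..<n} (\<lambda>_. 0) (\<lambda>_. None)" using auction_state_init by simp
  fix R r'
  assume "n = Suc r'" and main: "main_mem R (\<lambda>_. 0) (\<lambda>_. None) r'" and R: "R 6 = real (Suc r' * n)"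
  then have *: "{r'..<n} - {r'} = {}" "r' \<in> {r'..<n}" by auto
  have "auction_state n adj ({r'..<n} - {r'}) (\<lambda>_. 0) (\<lambda>_. None)"
    unfolding * by (rule auction_state_init)
  from auction_rounds[OF main this *(2) R]
  show "halts_within (Suc (n * n) * (20 * n + 20)) 41 R" by simp
qed simp

section \<open>Moving the input out of the working registers\<close>

lemma input_memory_entry:
  assumes "i < n" "j < n"
  shows "input_memory M (i * n + Suc j) = M $$ (i, j)"
proof -
  have "(i * n + j) div n = i" "(i * n + j) mod n = j" using assms by auto
  then show ?thesis
    using M entry_le[OF assms] by (simp add: input_memory_def Let_def)
qed

lemma input_memory_outside: "n * n < k \<Longrightarrow> input_memory M k = 0"
  using M by (simp add: input_memory_def Let_def)

lemma input_memory_in_V: "range (input_memory M) \<subseteq> V"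
proof (rule image_subsetI)
  fix k
  show "input_memory M k \<in> V"
  proof (cases "k = 0 \<or> n * n < k")
    case True
    then show ?thesis
      using M V_nat[of n] V_nat[of 0] D_ge by (auto simp: input_memory_def Let_def)
  next
    case False
    then have "k - 1 < n * n" by linarith
    moreover from this have "0 < n" by (cases "n = 0") simp_all
    ultimately have "(k - 1) div n < n" "(k - 1) mod n < n"
      by (simp_all add: less_mult_imp_div_less)
    moreover have "input_memory M k = M $$ ((k - 1) div n, (k - 1) mod n)"
      using False M by (simp add: input_memory_def Let_def)
    ultimately show ?thesis unfolding V_def by blast
  qed
qed

text \<open>The branches on the first entry meet here. Register 2, whose input is already saved at
  \<open>D + 2\<close>, now carries a flag telling whether that entry vanishes.\<close>

lemma relocate:
  assumes R: "R 0 = real (n + 10)" "R 1 = real (D + 1)" "R (D + 2) = input_memory M 2"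
    and R2: "R 2 = 0 \<longleftrightarrow> input_memory M 1 = 0"
    and rest: "\<And>k. k \<notin> {0, 1, 2, D + 2} \<Longrightarrow> R k = input_memory M k"
  shows "halts_within (Suc (n * n) * (20 * n + 20) + 25) 16 R"
proof -
  define t where "t = Suc (n * n) * (20 * n + 20) + 3"
  let ?I = "input_memory M"
  have start: "halts_within t 38 R'"
    if "R' 0 = real n" "R' 1 = real D" "R' 2 = 1" "R' 9 = real (n * n)"
      "R' (D + 1) = R 2" "\<And>k. 2 \<le> k \<Longrightarrow> k \<le> 9 \<Longrightarrow> R' (D + k) = ?I k"
      "\<And>k. 9 < k \<Longrightarrow> k \<le> D \<or> D + 9 < k \<Longrightarrow> R' k = ?I k" for R'
    unfolding t_def
  proof (rule auction_start)
    have "R' (loc k) \<noteq> 0 \<longleftrightarrow> ?I k \<noteq> 0" if "0 < k" "k \<le> n * n" for k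
      using \<open>R' (D + 1) = R 2\<close> R2 \<open>\<And>k. 2 \<le> k \<Longrightarrow> k \<le> 9 \<Longrightarrow> R' (D + k) = ?I k\<close>[of k]
        \<open>\<And>k. 9 < k \<Longrightarrow> k \<le> D \<or> D + 9 < k \<Longrightarrow> R' k = ?I k\<close>[of k] D_ge that
      by (cases "k = 1") (auto simp: loc_def)
    then have "R' (loc (i * n + Suc j)) \<noteq> 0 \<longleftrightarrow> adj i j" if "i < n" "j < n" for i j
      using entry_le[OF that] input_memory_entry[OF that] by simp
    \<comment> \<open>Registers beyond the input start at 0, which already encodes zero prices and
      no owners.\<close>
    moreover have "R' (2 * D + Suc j) = 0" "R' (3 * D + Suc j) = 0" for j
      using that(7) D_ge by (simp_all add: input_memory_outside)
    ultimately show "main_mem R' (\<lambda>_. 0) (\<lambda>_. None) n"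
      using that by (simp add: main_mem_def)
  qed
  have low: "R 3 = ?I 3" "R 4 = ?I 4" "R 5 = ?I 5" "R 6 = ?I 6" "R 7 = ?I 7" "R 8 = ?I 8"
      "R 9 = ?I 9" using D_ge by (auto intro!: rest)
  have "halts_within (t + 22) 16 R"
  proof -
    note facts = R low D_ge
    show ?thesis
      apply (rule halts_Store[OF matching_program_nth(17), where k = "D + 1" and x = "R 2"]; (use facts in \<open>simp; fail\<close>)?)
      apply (rule step_Const[OF matching_program_nth(18), where k = 1]; (use facts in \<open>simp; fail\<close>)?)
      apply (rule step_Add[OF matching_program_nth(19), where k = "D + 2"]; (use facts in \<open>simp; fail\<close>)?)
      apply (rule step_Add[OF matching_program_nth(20), where k = "D + 3"]; (use facts in \<open>simp; fail\<close>)?)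
      apply (rule halts_Store[OF matching_program_nth(21), where k = "D + 3" and x = "?I 3"]; (use facts in \<open>simp; fail\<close>)?)
      apply (rule step_Add[OF matching_program_nth(22), where k = "D + 4"]; (use facts in \<open>simp; fail\<close>)?)
      apply (rule halts_Store[OF matching_program_nth(23), where k = "D + 4" and x = "?I 4"]; (use facts in \<open>simp; fail\<close>)?)
      apply (rule step_Add[OF matching_program_nth(24), where k = "D + 5"]; (use facts in \<open>simp; fail\<close>)?)
      apply (rule halts_Store[OF matching_program_nth(25), where k = "D + 5" and x = "?I 5"]; (use facts in \<open>simp; fail\<close>)?)
      apply (rule step_Add[OF matching_program_nth(26), where k = "D + 6"]; (use facts in \<open>simp; fail\<close>)?)
      apply (rule halts_Store[OF matching_program_nth(27), where k = "D + 6" and x = "?I 6"]; (use facts in \<open>simp; fail\<close>)?)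
      apply (rule step_Add[OF matching_program_nth(28), where k = "D + 7"]; (use facts in \<open>simp; fail\<close>)?)
      apply (rule halts_Store[OF matching_program_nth(29), where k = "D + 7" and x = "?I 7"]; (use facts in \<open>simp; fail\<close>)?)
      apply (rule step_Add[OF matching_program_nth(30), where k = "D + 8"]; (use facts in \<open>simp; fail\<close>)?)
      apply (rule halts_Store[OF matching_program_nth(31), where k = "D + 8" and x = "?I 8"]; (use facts in \<open>simp; fail\<close>)?)
      apply (rule step_Add[OF matching_program_nth(32), where k = "D + 9"]; (use facts in \<open>simp; fail\<close>)?)
      apply (rule halts_Store[OF matching_program_nth(33), where k = "D + 9" and x = "?I 9"]; (use facts in \<open>simp; fail\<close>)?)
      apply (rule step_Const[OF matching_program_nth(34), where k = 9]; (use facts in \<open>simp; fail\<close>)?)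
      apply (rule step_Sub[OF matching_program_nth(35), where k = D]; (use facts in \<open>simp; fail\<close>)?)
      apply (rule step_Const[OF matching_program_nth(36), where k = 10]; (use facts in \<open>simp; fail\<close>)?)
      apply (rule step_Sub[OF matching_program_nth(37), where k = n]; (use facts in \<open>simp; fail\<close>)?)
      apply (rule step_Mul[OF matching_program_nth(38), where k = "n * n"]; (use facts in \<open>simp; fail\<close>)?)
      apply (rule start)
      subgoal using facts by simp
      subgoal using facts by simp
      subgoal using facts by simp
      subgoal using facts by simp
      subgoal using facts by simp
      subgoal for k
      proof -
        assume "2 \<le> k" "k \<le> 9"
        then have "k \<in> {2, 3, 4, 5, 6, 7, 8, 9}" by auto
        then show ?thesis using facts by auto
      qed
      subgoal for k
      proof -
        assume "9 < k" "k \<le> D \<or> D + 9 < k"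
        then have "k \<notin> {0, 1, 2, 3, 9, D + 1, D + 2, D + 3, D + 4, D + 5, D + 6, D + 7, D + 8, D + 9}"
          using D_ge by auto
        then show ?thesis using rest[of k] by simp
      qed
      done
  qed
  then show ?thesis by (simp add: t_def)
qed

lemma program_halts: "halts_within (Suc (n * n) * (20 * n + 20) + 40) 0 (input_memory M)"
proof (cases "n = 0")
  case True
  \<comment> \<open>For \<open>n = 0\<close> the empty permutation is a perfect matching.\<close>
  then have "\<not> ans" unfolding ans perfect_matching_def using permutes_id[of "{0..<n}"] by auto
  then have halt: "matching_program ! 77 = Halt ans" by (simp add: matching_program_nth)
  have facts: "input_memory M 0 = 0" using True M by (simp add: input_memory_def)
  show ?thesis
    apply (rule halts_Jump_Zero[OF matching_program_nth(1)]; (use facts in \<open>simp; fail\<close>)?)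
    by (rule halts_Halt[OF halt]) auto
next
  case False
  define t where "t = Suc (n * n) * (20 * n + 20) + 25"
  let ?I = "input_memory M"
  have I0: "?I 0 = real n" using M by (simp add: input_memory_def)
  have cont: "halts_within (k + t) 16 R"
    if "R 0 = real (n + 10)" "R 1 = real (D + 1)" "R (D + 2) = ?I 2" "R 2 = 0 \<longleftrightarrow> ?I 1 = 0"
      "\<And>k. k \<notin> {0, 1, 2, D + 2} \<Longrightarrow> R k = ?I k" for R k
  proof -
    have "halts_within t 16 R" unfolding t_def using that by (rule relocate)
    then show ?thesis by (rule halts_mono) simp
  qed
  have sq: "(10 + real n) * (10 + real n) = 2 + real D" "(real n + 10) * (real n + 10) = real D + 2"
    by (simp_all add: D_def algebra_simps)
  note facts = I0 False D_ge
  have "halts_within (t + 15) 0 ?I"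
    apply (rule halts_Jump_Zero[OF matching_program_nth(1), where pc' = 1]; (use facts in \<open>simp; fail\<close>)?)
    apply (rule halts_Jump_Zero[OF matching_program_nth(2), where pc' = 2]; (use facts in \<open>simp; fail\<close>)?)
     \<comment> \<open>Both branches do the same work and differ in the flag left in register 2: 0
       here, for a vanishing first entry, and 1 in the other.\<close>
     apply (rule step_Const[OF matching_program_nth(10), where k = 10]; (use facts in \<open>simp; fail\<close>)?)
     apply (rule step_Add[OF matching_program_nth(11), where k = "n + 10"]; (use facts in \<open>simp; fail\<close>)?)
     apply (rule step_Mul[OF matching_program_nth(12), where k = "D + 2"]; (use facts in \<open>simp; fail\<close>)?)
      apply (simp add: sq)
     apply (rule halts_Store[OF matching_program_nth(13), where k = "D + 2" and x = "?I 2"]; (use facts in \<open>simp; fail\<close>)?)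
     apply (rule step_Const[OF matching_program_nth(14), where k = 1]; (use facts in \<open>simp; fail\<close>)?)
     apply (rule step_Sub[OF matching_program_nth(15), where k = "D + 1"]; (use facts in \<open>simp; fail\<close>)?)
     apply (rule step_Const[OF matching_program_nth(16), where k = 0]; (use facts in \<open>simp; fail\<close>)?)
     apply (rule cont; use facts in auto)
    apply (rule step_Const[OF matching_program_nth(3), where k = 10]; (use facts in \<open>simp; fail\<close>)?)
    apply (rule step_Add[OF matching_program_nth(4), where k = "n + 10"]; (use facts in \<open>simp; fail\<close>)?)
    apply (rule step_Mul[OF matching_program_nth(5), where k = "D + 2"]; (use facts in \<open>simp; fail\<close>)?)
     apply (simp add: sq)
    apply (rule halts_Store[OF matching_program_nth(6), where k = "D + 2" and x = "?I 2"]; (use facts in \<open>simp; fail\<close>)?)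
    apply (rule step_Const[OF matching_program_nth(7), where k = 1]; (use facts in \<open>simp; fail\<close>)?)
    apply (rule step_Sub[OF matching_program_nth(8), where k = "D + 1"]; (use facts in \<open>simp; fail\<close>)?)
    apply (rule halts_Jump[OF matching_program_nth(9)]; (use facts in \<open>simp; fail\<close>)?)
    apply (rule cont; use facts in auto)
    done
  then show ?thesis by (simp add: t_def)
qed

end

subsection \<open>Logarithmic cost\<close>

text \<open>A linear bound is enough, since the integers computed by the program have magnitude
  polynomial in \<open>n\<close>.\<close>

lemma int_bits_le: "int_bits z \<le> Suc (nat \<bar>z\<bar>)"
proof -
  have "floorlog 2 (nat \<bar>z\<bar>) \<le> nat \<bar>z\<bar>"
    by (rule floorlog_leI) (simp_all add: less_exp)
  then show ?thesis by (simp add: int_bits_def)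
qed

lemma rat_bits_of_int: "rat_bits (real_of_int z) = int_bits z + int_bits 1"
proof -
  have "(THE r. real_of_rat r = real_of_int z) = of_int z"
    by (rule the_equality) (simp, metis of_rat_eq_iff of_rat_of_int_eq)
  then show ?thesis by (simp add: rat_bits_def)
qed

text \<open>The bound 98 covers all register numbers, constants and jump targets of the program, the
  largest being 78.\<close>

definition small_instr :: "instr \<Rightarrow> bool" where
  "small_instr i \<longleftrightarrow> (case i of
      Const r z \<Rightarrow> r \<le> 98 \<and> \<bar>z\<bar> \<le> 98
    | Add r a b \<Rightarrow> r \<le> 98 \<and> a \<le> 98 \<and> b \<le> 98
    | Sub r a b \<Rightarrow> r \<le> 98 \<and> a \<le> 98 \<and> b \<le> 98
    | Mul r a b \<Rightarrow> r \<le> 98 \<and> a \<le> 98 \<and> b \<le> 98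
    | Div r a b \<Rightarrow> r \<le> 98 \<and> a \<le> 98 \<and> b \<le> 98
    | Load r a \<Rightarrow> r \<le> 98 \<and> a \<le> 98
    | Store r a \<Rightarrow> r \<le> 98 \<and> a \<le> 98
    | Jump l \<Rightarrow> l \<le> 98
    | Jump_Zero r l \<Rightarrow> r \<le> 98 \<and> l \<le> 98
    | Jump_Pos r l \<Rightarrow> r \<le> 98 \<and> l \<le> 98
    | Halt b \<Rightarrow> True)"

lemma small_matching_program: "i \<in> set matching_program \<Longrightarrow> small_instr i"
proof -
  have "\<forall>i\<in>set matching_program. small_instr i"
    by (simp add: matching_program_def small_instr_def)
  then show "i \<in> set matching_program \<Longrightarrow> small_instr i" by blast
qed

text \<open>An instruction involves at most three literals of cost at most 99 each and two register
  contents.\<close>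

lemma instr_cost_le:
  assumes "small_instr i" and bits: "\<And>a. rat_bits (R a) \<le> B"
  shows "instr_cost i R \<le> 297 + 2 * B"
proof -
  have small: "int_bits (int k) \<le> 99" if "k \<le> 98" for k
    using int_bits_le[of "int k"] that by simp
  have small_int: "int_bits z \<le> 99" if "\<bar>z\<bar> \<le> 98" for z
    using int_bits_le[of z] that by linarith
  have five: "int_bits (int r) + int_bits (int u) + int_bits (int v) + rat_bits (R a) + rat_bits (R b)
      \<le> 297 + 2 * B" if "r \<le> 98" "u \<le> 98" "v \<le> 98" for r u v a b
    using small[OF that(1)] small[OF that(2)] small[OF that(3)] bits[of a] bits[of b] by linarith
  have four: "int_bits (int r) + int_bits (int u) + rat_bits (R a) + rat_bits (R b) \<le> 297 + 2 * B"
    if "r \<le> 98" "u \<le> 98" for r u a b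
    using small[OF that(1)] small[OF that(2)] bits[of a] bits[of b] by linarith
  have three: "int_bits (int r) + int_bits (int u) + rat_bits (R a) \<le> 297 + 2 * B"
    if "r \<le> 98" "u \<le> 98" for r u a
    using four[OF that, of a a] by linarith
  have const: "int_bits (int r) + int_bits z \<le> 297 + 2 * B" if "r \<le> 98" "\<bar>z\<bar> \<le> 98" for r z
    using small[OF that(1)] small_int[OF that(2)] by linarith
  have jump: "int_bits (int l) \<le> 297 + 2 * B" if "l \<le> 98" for l
    using small[OF that] by linarith
  show ?thesis
    using assms(1) five four three const jump by (cases i) (simp_all add: small_instr_def)
qed

lemma nat_poly_mono: "a \<le> b \<Longrightarrow> poly p a \<le> poly p b" for p :: "nat poly"
  by (induction p) (auto intro: add_le_mono mult_le_mono)

text \<open>With constant terms first, this is the step bound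
  \<open>(1 + n\<^sup>2) * (20 + 20 * n) + 40\<close>.\<close>

definition time_poly :: "nat poly" where
  "time_poly = [:1, 0, 1:] * [:20, 20:] + [:40:]"

text \<open>The cost bound \<open>297 + 2 * (4 * D + 3 + b)\<close> of one instruction, with
  \<open>D\<close> evaluated at the bit size \<open>b\<close> instead of \<open>n\<close>.\<close>

definition cost_poly :: "nat poly" where
  "cost_poly = [:297:] + [:2:] * ([:4:] * [:98, 20, 1:] + [:3, 1:])"

context matching_machine
begin

lemma rat_bits_V:
  assumes "x \<in> V"
  shows "rat_bits x \<le> 4 * D + 3 + bit_size M"
proof -
  from assms consider z where "x = real_of_int z" "\<bar>z\<bar> \<le> int (4 * D)"
    | i j where "x = M $$ (i, j)" "i < n" "j < n"
    unfolding V_def by blast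
  then show ?thesis
  proof cases
    case 1
    then have "int_bits z \<le> Suc (4 * D)" using int_bits_le[of z] by linarith
    moreover have "int_bits 1 \<le> 2" using int_bits_le[of 1] by simp
    ultimately show ?thesis by (simp add: 1 rat_bits_of_int)
  next
    case 2
    have "rat_bits (M $$ (i, j)) \<le> (\<Sum>j<n. rat_bits (M $$ (i, j)))"
      using 2 by (intro member_le_sum) auto
    also have "\<dots> \<le> (\<Sum>i<n. \<Sum>j<n. rat_bits (M $$ (i, j)))"
      using 2 by (intro member_le_sum[of i "{..<n}" "\<lambda>i. \<Sum>j<n. rat_bits (M $$ (i, j))"]) auto
    finally show ?thesis using 2 M by (simp add: bit_size_def)
  qed
qed

text \<open>Each of the \<open>n * n\<close> entries has at least one bit; bounds in the dimension
  thus become bounds in the bit size.\<close>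

lemma dim_le_bit_size: "n \<le> bit_size M"
proof -
  have "1 \<le> rat_bits x" for x
    by (simp add: rat_bits_def int_bits_def split: prod.split)
  then have "(\<Sum>i<n. \<Sum>j<n. 1) \<le> (\<Sum>i<n. \<Sum>j<n. rat_bits (M $$ (i, j)))"
    by (intro sum_mono) auto
  then have "n * n \<le> bit_size M" using M by (simp add: bit_size_def)
  then show ?thesis by (metis le_square le_trans)
qed

text \<open>The logarithmic cost is at most the number of steps times the largest cost of one
  instruction; monotonicity evaluates both at the bit size.\<close>

theorem program_correct:
  "\<exists>t. run matching_program M t = Halted ans \<and> t \<le> poly time_poly n \<and>
    log_cost matching_program M t \<le> poly (time_poly * cost_poly) (bit_size M)"
proof -
  let ?s = "Running 0 (input_memory M)"
  have "mem_ok V ?s" using input_memory_in_V by (simp add: mem_ok_def)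
  then obtain t where t: "t \<le> Suc (n * n) * (20 * n + 20) + 40"
      "run matching_program M t = Halted ans" "\<And>m. m < t \<Longrightarrow> mem_ok V (run matching_program M m)"
    using program_halts unfolding halts_def run_def by blast
  have time: "t \<le> poly time_poly n"
    using t(1) by (simp add: time_poly_def algebra_simps)
  let ?b = "bit_size M"
  have "instr_cost i R \<le> 297 + 2 * (4 * D + 3 + ?b)"
    if "i \<in> set matching_program" "range R \<subseteq> V" for i R
    using instr_cost_le[OF small_matching_program[OF that(1)]] rat_bits_V that(2) by blast
  then have "log_cost matching_program M t \<le> t * (297 + 2 * (4 * D + 3 + ?b))"
    using t(3) by (rule log_cost_le)
  also have "\<dots> \<le> poly time_poly ?b * poly cost_poly ?b"
  proof (rule mult_le_mono)
    show "t \<le> poly time_poly ?b"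
      using time nat_poly_mono[OF dim_le_bit_size, of time_poly] by linarith
    have "D \<le> poly [:98, 20, 1:] ?b"
      using nat_poly_mono[OF dim_le_bit_size, of "[:98, 20, 1:]"] by (simp add: D_def algebra_simps)
    then show "297 + 2 * (4 * D + 3 + ?b) \<le> poly cost_poly ?b"
      by (simp add: cost_poly_def algebra_simps)
  qed
  finally show ?thesis using t(2) time by auto
qed

end

section \<open>The equivalence and the decision procedure\<close>

theorem theorem4:
  shows "(\<forall>(n :: nat) (M :: real mat). M \<in> carrier_mat n n \<and> sym_mat M \<longrightarrow>
            ((\<forall>s. sym_signing n s \<longrightarrow> singular_mat (signed_mat M s)) \<longleftrightarrow>
             \<not> (\<exists>x. perfect_2_matching (support_graph M) x))) \<and>
         poly_time_decidable
           {M. square_mat M \<and> sym_mat M}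
           (\<lambda>M. \<forall>s. sym_signing (dim_row M) s \<longrightarrow> singular_mat (signed_mat M s))"
proof (intro conjI allI impI)
  fix n :: nat and M :: "real mat"
  assume M: "M \<in> carrier_mat n n \<and> sym_mat M"
  then show "(\<forall>s. sym_signing n s \<longrightarrow> singular_mat (signed_mat M s)) \<longleftrightarrow>
      \<not> (\<exists>x. perfect_2_matching (support_graph M) x)"
    using all_signings_singular_iff perfect_2_matching_if_perfect_matching
      perfect_matching_if_perfect_2_matching
    unfolding perfect_matching_def by metis
next
  show "poly_time_decidable {M. square_mat M \<and> sym_mat M}
      (\<lambda>M. \<forall>s. sym_signing (dim_row M) s \<longrightarrow> singular_mat (signed_mat M s))"
    unfolding poly_time_decidable_def
  proof (rule exI[of _ matching_program], rule exI[of _ time_poly],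
      rule exI[of _ "time_poly * cost_poly"], rule ballI)
    fix M :: "real mat"
    assume "M \<in> {M. square_mat M \<and> sym_mat M}"
    then have M: "M \<in> carrier_mat (dim_row M) (dim_row M)" "sym_mat M" by auto
    let ?ans = "\<forall>s. sym_signing (dim_row M) s \<longrightarrow> singular_mat (signed_mat M s)"
    \<comment> \<open>The expected answer is the singularity property itself; the permutation
      criterion shows that it is what the machine decides.\<close>
    interpret matching_machine "dim_row M" M ?ans
      by (rule matching_machine.intro[OF M(1)],
          unfold perfect_matching_def, rule all_signings_singular_iff[OF M])
    show "\<exists>t. run matching_program M t = Halted ?ans \<and> t \<le> poly time_poly (dim_row M) \<and>
        (rational_mat M \<longrightarrow> log_cost matching_program M t \<le> poly (time_poly * cost_poly) (bit_size M))"
      using program_correct by blast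
  qed
qed

end
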